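(* There exist an absolute constant $C>0$ and, for each $\varepsilon$, a constant $C_1=C_1(\varepsilon)>0$ depending only on $\varepsilon$ such that the following holds. Let $0<\delta<\frac23$, and let $M,A\in\mathbb{N}$ satisfy $M\ge 2^{4/\delta}$ and $A=M^\delta$. Then for every $0<\varepsilon<\frac{\delta}{2}$ there exists $\mathbb{G}\subset\mathbb{A}^\infty$ with $$\mu^\infty\left(\mathbb{A}^\infty\setminus\mathbb{G}\right)\le C_1e^{-\frac{M^\varepsilon}{C}}$$ such that each Cantor measure $\nu$ arising from an element of $\mathbb{G}$ satisfies $$\left\|\int_{\mathbb{R}}e^{-\frac{ix\xi}{h}}u(x)\,d\nu(x)\right\|_{L^2_\nu(\mathbb{R})}\le Ch^{\frac\delta4-\varepsilon}\|u\|_{L^2_\nu(\mathbb{R})}\quad\text{for all }u\in L^2_\nu(\mathbb{R})\text{ and }0<h<M^{-8},$$ where the norm on the left-hand side is taken with respect to the variable $\xi$.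
   Context: Random Cantor sets and measures. For $M,A\in\mathbb{N}$ with $A=M^\delta$, $0<\delta<1$, let $\mathbb{A}(M,A)=\{\mathcal{A}\subset\{0,\dots,M-1\}:\mathrm{Card}(\mathcal{A})=A\}$, equipped with the uniform (normalized counting) probability measure. Define inductively $B_1=\frac1M\mathcal{A}$ with $\mathcal{A}\in\mathbb{A}(M,A)$, and for $j\ge2$, $$B_j=\bigcup_{b\in B_{j-1}}\left\{b+\frac{a}{M^j}:a\in\mathcal{A}(b)\right\},$$ where $\mathcal{A}(b)\in\mathbb{A}(M,A)$, $b\in B_{j-1}$, are independent and uniformly distributed on $\mathbb{A}(M,A)$. Thus $\mathrm{Card}(B_j)=A^j$. Set $$\mathcal{C}_j=\bigcup_{b\in B_j}\left[b,b+\frac{1}{M^j}\right],\qquad \mathcal{C}=\bigcap_{j=1}^\infty\mathcal{C}_j\subset[0,1].$$ Let $\nu_j$ be the Borel measure on $\mathbb{R}$ with density $\rho_j(x)=\frac{M^j}{A^j}\mathbf{1}_{\mathcal{C}_j}(x)$ with respect to Lebesgue measure. The Cantor measure $\nu$ is the weak limit of $\nu_j$ as $j\to\infty$; it is a probability measure supported on $\mathcal{C}$. Probability space. The choices made at the $j$-th iteration form the space $\mathbb{A}(M,A)^{A^{j-1}}$ (one alphabet for each of the $A^{j-1}$ elements of $B_{j-1}$, enumerated in increasing order; one alphabet if $j=1$) with the uniform probability measure $\mu_j$. Set $\mathbb{A}^\infty=\prod_{j=1}^\infty\mathbb{A}(M,A)^{A^{j-1}}$ with the product probability measure $\mu^\infty=\prod_{j=1}^\infty\mu_j$.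 Each element of $\mathbb{A}^\infty$ determines a Cantor set $\mathcal{C}$ and a Cantor measure $\nu$: its first component is the alphabet $\mathcal{A}$ giving $B_1=\frac1M\mathcal{A}$; for $j\ge2$, the $k$-th alphabet in its $j$-th component is taken as $\mathcal{A}(b)$ for the $k$-th smallest element $b$ of $B_{j-1}$, giving $B_j=\bigcup_{b\in B_{j-1}}\{b+\frac{a}{M^j}:a\in\mathcal{A}(b)\}$; then $\mathcal{C}=\bigcap_{j=1}^\infty\mathcal{C}_j$ with $\mathcal{C}_j=\bigcup_{b\in B_j}[b,b+\frac{1}{M^j}]$, and $\nu$ is the weak limit as $j\to\infty$ of the measures $\nu_j$ with density $\frac{M^j}{A^j}\mathbf{1}_{\mathcal{C}_j}$. Notation. $L^2_\nu(\mathbb{R})$ is the $L^2$ space on $\mathbb{R}$ with respect to the measure $\nu$. *)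

theory Defs
  imports "HOL-Probability.Probability"
begin

definition alphabets :: "nat \<Rightarrow> nat \<Rightarrow> nat set set" where
  "alphabets M A = {\<A>. \<A> \<subseteq> {0..<M} \<and> card \<A> = A}"

definition mu_step :: "nat \<Rightarrow> nat \<Rightarrow> nat \<Rightarrow> (nat \<Rightarrow> nat set) measure" where
  "mu_step M A j = uniform_count_measure (\<Pi>\<^sub>E k\<in>{..<A ^ (j - 1)}. alphabets M A)"

definition mu_inf :: "nat \<Rightarrow> nat \<Rightarrow> (nat \<Rightarrow> nat \<Rightarrow> nat set) measure" where
  "mu_inf M A = (\<Pi>\<^sub>M j\<in>{1..}. mu_step M A j)"

text \<open>
  The alphabets of one step are numbered from \<open>0\<close>, so the alphabet attached to \<open>b\<close> is the one
  whose number is the number of elements of the previous stage smaller than \<open>b\<close>. Starting from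
  \<open>{0}\<close> at stage \<open>0\<close>, stage \<open>1\<close> is \<open>(1/M) \<A>\<close> with \<open>\<A> = w 1 0\<close>.
\<close>

fun cantor_points :: "nat \<Rightarrow> (nat \<Rightarrow> nat \<Rightarrow> nat set) \<Rightarrow> nat \<Rightarrow> real set" where
  "cantor_points M w 0 = {0}"
| "cantor_points M w (Suc j) =
    (\<Union>b\<in>cantor_points M w j.
      {b + real a / real M ^ Suc j | a.
        a \<in> w (Suc j) (card {c \<in> cantor_points M w j. c < b})})"

definition cantor_stage :: "nat \<Rightarrow> (nat \<Rightarrow> nat \<Rightarrow> nat set) \<Rightarrow> nat \<Rightarrow> real set" where
  "cantor_stage M w j = (\<Union>b\<in>cantor_points M w j. {b .. b + 1 / real M ^ j})"

definition stage_measure ::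
    "nat \<Rightarrow> nat \<Rightarrow> (nat \<Rightarrow> nat \<Rightarrow> nat set) \<Rightarrow> nat \<Rightarrow> real measure" where
  "stage_measure M A w j =
    density lborel (\<lambda>x. ennreal (real M ^ j / real A ^ j * indicator (cantor_stage M w j) x))"

text \<open>
  For \<open>w\<close> in the space of \<open>mu_inf M A\<close> and \<open>0 < A\<close>, the measures \<open>stage_measure M A w j\<close> are Borel
  probability measures on the line having exactly one weak limit among such measures, so the
  description is proper.
\<close>

definition cantor_measure :: "nat \<Rightarrow> nat \<Rightarrow> (nat \<Rightarrow> nat \<Rightarrow> nat set) \<Rightarrow> real measure" where
  "cantor_measure M A w =
    (THE \<nu>. real_distribution \<nu> \<and> weak_conv_m (stage_measure M A w) \<nu>)"

definition L2_fun :: "real measure \<Rightarrow> (real \<Rightarrow> complex) set" where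
  "L2_fun \<nu> = {u \<in> borel_measurable \<nu>. integrable \<nu> (\<lambda>x. (cmod (u x))\<^sup>2)}"

definition L2_nrm :: "real measure \<Rightarrow> (real \<Rightarrow> complex) \<Rightarrow> real" where
  "L2_nrm \<nu> u = sqrt (LINT x|\<nu>. (cmod (u x))\<^sup>2)"

definition fourier_op :: "real measure \<Rightarrow> real \<Rightarrow> (real \<Rightarrow> complex) \<Rightarrow> real \<Rightarrow> complex" where
  "fourier_op \<nu> h u \<xi> = (LINT x|\<nu>. exp (- (\<i> * of_real x * of_real \<xi> / of_real h)) * u x)"

end

theory Submission
  imports Defs "HOL-Real_Asymp.Real_Asymp"
begin

text \<open>
  By Schur's test, the square of the operator norm is at most the supremum over \<open>x\<close> of the
  \<open>\<nu>\<close>-integral of \<open>y \<mapsto> |\<nu>^((x - y) / h)|\<close>, where \<open>\<nu>^\<close> is the characteristic function. With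
  \<open>\<alpha> = \<delta>/2 - \<epsilon>\<close> it therefore suffices that, outside a small exceptional set, \<open>|\<nu>^(t)|\<close> is
  \<open>O(|t| powr -\<alpha>)\<close> and the \<open>\<alpha>\<close>-energies \<open>\<integral> |x - y| powr -\<alpha> d\<nu>(y)\<close> are bounded uniformly in
  \<open>x\<close>, both with absolute constants.

  Decay: conditionally on the first \<open>j - 1\<close> steps, \<open>\<nu>^\<^sub>j(t) - \<nu>^\<^sub>j\<^sub>-\<^sub>1(t)\<close> is \<open>(exp(\<i> s) - 1) / (\<i> s)\<close>
  at \<open>s = t / M^j\<close> times a mean zero sum over independent alphabets. Maclaurin's inequality compares a
  uniform random subset with independent sampling, so Hoeffding's lemma makes this sum subgaussian of
  variance about \<open>A^(-j)\<close>. It is \<open>2\<pi>M^j\<close>-periodic and Lipschitz in \<open>t\<close>, so a union bound over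
  \<open>O(M^(2j))\<close> points bounds it by \<open>4 M^(-\<alpha> j)\<close> for all \<open>t\<close> simultaneously. The sum over \<open>j\<close> is
  geometric on both sides of the scale \<open>M^j \<approx> |t|\<close>.

  Energy: at distances below \<open>1/M\<close> it is enough that an interval of length \<open>M^(-i)\<close> meets at most three
  cells of mass \<open>A^(-i)\<close>. At distances above \<open>1/M\<close> this would lose a factor \<open>M^\<alpha>\<close>; there the
  randomness of the first alphabet is used.

  If \<open>\<epsilon> \<ge> \<delta>/4\<close> the trivial bound by \<open>1\<close> suffices, and \<open>M\<close> below a threshold depending on \<open>\<epsilon>\<close> is
  absorbed into \<open>C\<^sub>1\<close>.
\<close>

section \<open>Concentration for random subsets\<close>

text \<open>Convexity: a power lies above its tangent at \<open>p\<close>. Multiplying the inductive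
  hypothesis by \<open>q\<close> overshoots the next tangent exactly by the nonnegative square term
  subtracted in the first step.\<close>

lemma power_above_tangent:
  fixes p q :: real
  assumes "0 \<le> p" "0 \<le> q"
  shows "p ^ Suc k + real (Suc k) * (q - p) * p ^ k \<le> q ^ Suc k"
proof (induction k)
  case (Suc k)
  have "p ^ Suc (Suc k) + real (Suc (Suc k)) * (q - p) * p ^ Suc k
      = q * (p ^ Suc k + real (Suc k) * (q - p) * p ^ k) - real (Suc k) * (q - p)\<^sup>2 * p ^ k"
    by (simp add: algebra_simps power2_eq_square)
  also have "\<dots> \<le> q * (p ^ Suc k + real (Suc k) * (q - p) * p ^ k)"
    using assms by simp
  also have "\<dots> \<le> q * q ^ Suc k"
    using Suc.IH assms by (intro mult_left_mono) auto
  finally show ?case by simp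
qed auto

text \<open>Maclaurin's inequality. It replaces sampling without replacement by independent sampling.\<close>

lemma sum_subsets_prod_le:
  fixes x :: "'a \<Rightarrow> real"
  assumes "finite X" "\<And>a. a \<in> X \<Longrightarrow> 0 \<le> x a"
  shows "(\<Sum>S | S \<subseteq> X \<and> card S = k. \<Prod>a\<in>S. x a)
    \<le> real (card X choose k) * ((\<Sum>a\<in>X. x a) / real (card X)) ^ k"
  using assms
proof (induction X arbitrary: k rule: finite_induct)
  case empty
  have "{S. S \<subseteq> ({} :: 'a set) \<and> card S = k} = (if k = 0 then {{}} else {})" by auto
  then show ?case by simp
next
  case (insert b X)
  let ?e = "\<lambda>X k. (\<Sum>S | S \<subseteq> X \<and> card S = k. \<Prod>a\<in>S. x a)"
  show ?case
  proof (cases k)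
    case 0
    have "{S. S \<subseteq> insert b X \<and> card S = 0} = {{}}"
      using insert.hyps finite_subset[of _ "insert b X"] by auto
    with 0 show ?thesis by simp
  next
    case (Suc m)
    \<comment> \<open>Splitting subsets by whether they contain \<open>b\<close> yields the
      Pascal-type recursion \<open>e\<close> for elementary symmetric polynomials.\<close>
    have 1: "{S. S \<subseteq> insert b X \<and> card S = Suc m}
        = {S. S \<subseteq> X \<and> card S = Suc m} \<union> insert b ` {S. S \<subseteq> X \<and> card S = m}" (is "?L = ?R")
    proof
      show "?L \<subseteq> ?R"
      proof
        fix S assume S: "S \<in> ?L"
        then have "finite S" using insert.hyps finite_subset[of S "insert b X"] by auto
        show "S \<in> ?R"
        proof (cases "b \<in> S")
          case True
          then have "S = insert b (S - {b})" "S - {b} \<subseteq> X" "card (S - {b}) = m"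
            using S \<open>finite S\<close> by auto
          then show ?thesis by blast
        next
          case False
          then show ?thesis using S by auto
        qed
      qed
      show "?R \<subseteq> ?L"
        using insert.hyps finite_subset[of _ X] by (auto simp: card_insert_if)
    qed
    have fin: "finite {S. S \<subseteq> X \<and> card S = j}" for j
      by (rule finite_subset[of _ "Pow X"]) (use insert.hyps in auto)
    have "?e (insert b X) (Suc m)
        = ?e X (Suc m) + (\<Sum>S\<in>insert b ` {S. S \<subseteq> X \<and> card S = m}. \<Prod>a\<in>S. x a)"
      unfolding 1 using insert.hyps by (intro sum.union_disjoint fin finite_imageI) auto
    also have "(\<Sum>S\<in>insert b ` {S. S \<subseteq> X \<and> card S = m}. \<Prod>a\<in>S. x a)
        = (\<Sum>S | S \<subseteq> X \<and> card S = m. \<Prod>a\<in>insert b S. x a)"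
      using insert.hyps by (intro sum.reindex_cong[of "insert b"] inj_onI) auto
    also have "\<dots> = (\<Sum>S | S \<subseteq> X \<and> card S = m. x b * (\<Prod>a\<in>S. x a))"
      using insert.hyps finite_subset[of _ X] by (intro sum.cong refl prod.insert) auto
    also have "\<dots> = x b * ?e X m" by (simp add: sum_distrib_left)
    finally have e: "?e (insert b X) (Suc m) = ?e X (Suc m) + x b * ?e X m" .
    \<comment> \<open>\<open>p\<close> and \<open>q\<close> are the means before and after inserting
      \<open>b\<close>. By \<open>b1\<close> and \<open>qp\<close>, the inductive bound becomes
      \<open>real (Suc n choose Suc m)\<close> times the tangent of the power at \<open>p\<close>,
      evaluated at \<open>q\<close>.\<close>
    define n where "n = card X"
    define p where "p = (\<Sum>a\<in>X. x a) / real n"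
    define q where "q = ((\<Sum>a\<in>insert b X. x a) / real (Suc n))"
    have p0: "0 \<le> p" unfolding p_def using insert.prems by (auto intro!: divide_nonneg_nonneg sum_nonneg)
    have q0: "0 \<le> q" unfolding q_def using insert.prems by (auto intro!: divide_nonneg_nonneg sum_nonneg)
    have np: "real n * p = (\<Sum>a\<in>X. x a)"
      using insert.hyps by (cases "n = 0") (auto simp: p_def n_def)
    have q: "real (Suc n) * q = real n * p + x b"
      using insert.hyps np by (simp add: q_def)
    then have qp: "real (Suc n) * (q - p) = x b - p" by (simp add: algebra_simps)
    have b1: "real (Suc m) * real (Suc n choose Suc m) = real (Suc n) * real (n choose m)"
      by (metis Suc_times_binomial of_nat_mult)
    have b2: "real (Suc n choose Suc m) = real (n choose m) + real (n choose Suc m)" by simp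
    have "?e X (Suc m) + x b * ?e X m
        \<le> real (n choose Suc m) * p ^ Suc m + x b * (real (n choose m) * p ^ m)"
      using insert.IH[of "Suc m"] insert.IH[of m] insert.prems
      by (intro add_mono mult_left_mono) (auto simp: n_def p_def)
    also have "\<dots> = real (Suc n choose Suc m) * p ^ Suc m + real (n choose m) * (x b - p) * p ^ m"
      by (simp add: algebra_simps)
    also have "real (n choose m) * (x b - p) = real (Suc m) * real (Suc n choose Suc m) * (q - p)"
      unfolding b1 qp[symmetric] by simp
    also have "real (Suc n choose Suc m) * p ^ Suc m
          + real (Suc m) * real (Suc n choose Suc m) * (q - p) * p ^ m
        = real (Suc n choose Suc m) * (p ^ Suc m + real (Suc m) * (q - p) * p ^ m)"
      by (simp add: algebra_simps)
    also have "\<dots> \<le> real (Suc n choose Suc m) * q ^ Suc m"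
      by (intro mult_left_mono power_above_tangent p0 q0) auto
    finally show ?thesis
      using insert.hyps Suc e by (simp add: q_def n_def)
  qed
qed

lemma finite_alphabets [simp]: "finite (alphabets M A)"
  unfolding alphabets_def by (rule finite_subset[of _ "Pow {0..<M}"]) auto

lemma card_alphabets: "card (alphabets M A) = M choose A"
  unfolding alphabets_def using n_subsets[of "{0..<M}" A] by simp

text \<open>Maclaurin's inequality for the values \<open>exp (f a)\<close>: in exponential moments,
  choosing an alphabet without replacement is dominated by \<open>A\<close> independent uniform
  draws.\<close>

lemma sum_alphabets_exp_le:
  "(\<Sum>S\<in>alphabets M A. exp (\<Sum>a\<in>S. f a :: real))
    \<le> real (card (alphabets M A)) * ((\<Sum>a<M. exp (f a)) / real M) ^ A"
proof -
  have "(\<Sum>S\<in>alphabets M A. exp (\<Sum>a\<in>S. f a)) = (\<Sum>S\<in>alphabets M A. \<Prod>a\<in>S. exp (f a))"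
    by (intro sum.cong refl exp_sum) (auto simp: alphabets_def finite_subset)
  also have "\<dots> \<le> real (card (alphabets M A)) * ((\<Sum>a<M. exp (f a)) / real M) ^ A"
    using sum_subsets_prod_le[of "{0..<M}" "\<lambda>a. exp (f a)" A] card_alphabets[of M A]
    by (simp add: alphabets_def atLeast0LessThan)
  finally show ?thesis .
qed

text \<open>Hoeffding's lemma for the uniform law on \<open>{..<M}\<close>; the interval length 2
  turns its exponent \<open>s\<^sup>2 * 2\<^sup>2 / 8\<close> into
  \<open>s\<^sup>2 / 2\<close>.\<close>

lemma mean_exp_le:
  fixes f :: "nat \<Rightarrow> real"
  assumes "0 < M" "0 < s" "(\<Sum>a<M. f a) = 0" "\<And>a. a < M \<Longrightarrow> l \<le> f a \<and> f a \<le> l + 2"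
  shows "(\<Sum>a<M. exp (s * f a)) / real M \<le> exp (s\<^sup>2 / 2)"
proof -
  let ?p = "pmf_of_set {..<M}"
  have ne: "{..<M} \<noteq> {}" using assms by auto
  have set: "set_pmf ?p = {..<M}" using ne by (simp add: set_pmf_of_set)
  interpret interval_bounded_random_variable "measure_pmf ?p" f l "l + 2"
    by unfold_locales (use assms set in \<open>auto simp: AE_measure_pmf_iff\<close>)
  have "measure_pmf.expectation ?p f = 0"
    using integral_pmf_of_set[of "{..<M}" f] ne assms by simp
  from Hoeffdings_lemma_nn_integral_0[OF assms(2) this]
  have "nn_integral ?p (\<lambda>x. ennreal (exp (s * f x))) \<le> ennreal (exp (s\<^sup>2 / 2))"
    by simp
  also have "nn_integral ?p (\<lambda>x. ennreal (exp (s * f x))) 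
      = (\<Sum>a<M. ennreal (exp (s * f a))) / of_nat M"
    using nn_integral_pmf_of_set[of "{..<M}" "\<lambda>x. ennreal (exp (s * f x))"] ne by simp
  also have "\<dots> = ennreal ((\<Sum>a<M. exp (s * f a)) / real M)"
    using assms by (simp add: sum_nonneg divide_ennreal[symmetric] ennreal_of_nat_eq_real_of_nat)
  finally show ?thesis by simp
qed

text \<open>Chernoff bound for \<open>N\<close> draws, each subgaussian with variance proxy 1. It is
  phrased by counting, the form that \<open>measure_mu_inf_le\<close> expects for one step.\<close>

lemma chernoff_alphabets:
  fixes g :: "'k \<Rightarrow> nat \<Rightarrow> real" and M A :: nat
  assumes "finite K" "0 < M" "0 < \<tau>"
    and "\<And>k. k \<in> K \<Longrightarrow> (\<Sum>a<M. g k a) = 0"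
    and "\<And>k a. k \<in> K \<Longrightarrow> a < M \<Longrightarrow> l k \<le> g k a \<and> g k a \<le> l k + 2"
  defines "\<Omega> \<equiv> (\<Pi>\<^sub>E k\<in>K. alphabets M A)" and "N \<equiv> real (card K * A)"
  shows "real (card {y\<in>\<Omega>. N * \<tau> \<le> (\<Sum>k\<in>K. \<Sum>a\<in>y k. g k a)})
    \<le> exp (- (N * \<tau>\<^sup>2 / 2)) * real (card \<Omega>)"
proof -
  have fin: "finite \<Omega>" unfolding \<Omega>_def using assms by (intro finite_PiE) auto
  let ?Z = "\<lambda>y. \<Sum>k\<in>K. \<Sum>a\<in>y k. g k a"
  let ?E = "{y\<in>\<Omega>. N * \<tau> \<le> ?Z y}"
  \<comment> \<open>Markov's inequality with exponential parameter \<tau>, the minimiser of N s^2 /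
    2 - s N \<tau> over s.\<close>
  have "real (card ?E) * exp (\<tau> * (N * \<tau>)) = (\<Sum>y\<in>?E. exp (\<tau> * (N * \<tau>)))" by simp
  also have "\<dots> \<le> (\<Sum>y\<in>?E. exp (\<tau> * ?Z y))"
    using assms by (intro sum_mono) auto
  also have "\<dots> \<le> (\<Sum>y\<in>\<Omega>. exp (\<tau> * ?Z y))"
    using fin by (intro sum_mono2) auto
  also have "\<dots> = (\<Sum>y\<in>\<Omega>. \<Prod>k\<in>K. exp (\<Sum>a\<in>y k. \<tau> * g k a))"
    using assms by (simp add: sum_distrib_left exp_sum)
  \<comment> \<open>Independence of the alphabets: a sum over the product space of a product of
    one-coordinate functions factorises.\<close>
  also have "\<dots> = (\<Prod>k\<in>K. \<Sum>S\<in>alphabets M A. exp (\<Sum>a\<in>S. \<tau> * g k a))"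
    unfolding \<Omega>_def using assms by (subst prod_sum_PiE) auto
  also have "\<dots> \<le> (\<Prod>k\<in>K. real (card (alphabets M A)) * exp (\<tau>\<^sup>2 / 2) ^ A)"
  proof (rule prod_mono, safe)
    fix k assume k: "k \<in> K"
    show "0 \<le> (\<Sum>S\<in>alphabets M A. exp (\<Sum>a\<in>S. \<tau> * g k a))" by (intro sum_nonneg) auto
    have "(\<Sum>S\<in>alphabets M A. exp (\<Sum>a\<in>S. \<tau> * g k a))
        \<le> real (card (alphabets M A)) * ((\<Sum>a<M. exp (\<tau> * g k a)) / real M) ^ A"
      by (rule sum_alphabets_exp_le)
    also have "\<dots> \<le> real (card (alphabets M A)) * exp (\<tau>\<^sup>2 / 2) ^ A"
      using assms(2-5) k
      by (intro mult_left_mono power_mono mean_exp_le[where l = "l k"] divide_nonneg_nonneg sum_nonneg) auto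
    finally show "(\<Sum>S\<in>alphabets M A. exp (\<Sum>a\<in>S. \<tau> * g k a))
        \<le> real (card (alphabets M A)) * exp (\<tau>\<^sup>2 / 2) ^ A" .
  qed
  also have "\<dots> = real (card \<Omega>) * exp (N * \<tau>\<^sup>2 / 2)"
    unfolding \<Omega>_def N_def using assms(1)
    by (simp add: card_PiE power_mult_distrib exp_of_nat_mult[symmetric] field_simps flip: power_mult)
  finally have "real (card ?E) \<le> real (card \<Omega>) * exp (N * \<tau>\<^sup>2 / 2) / exp (\<tau> * (N * \<tau>))"
    by (simp add: field_simps)
  also have "\<dots> = real (card \<Omega>) * exp (N * \<tau>\<^sup>2 / 2 - \<tau> * (N * \<tau>))"
    by (simp add: exp_diff)
  also have "N * \<tau>\<^sup>2 / 2 - \<tau> * (N * \<tau>) = - (N * \<tau>\<^sup>2 / 2)"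
    by (simp add: power2_eq_square field_simps)
  finally show ?thesis by (simp add: mult.commute)
qed

section \<open>The integer points of the construction\<close>

text \<open>The points of stage \<open>j\<close> scaled by M^j: integers written in base
  \<open>M\<close>, where \<open>n * M + a\<close> appends the digit \<open>a\<close> and
  \<open>div M\<close> recovers the parent. Scaling keeps the order, so the ranks that select
  alphabets are those of \<open>cantor_points\<close>.\<close>

fun cantor_nums :: "nat \<Rightarrow> (nat \<Rightarrow> nat \<Rightarrow> nat set) \<Rightarrow> nat \<Rightarrow> nat set" where
  "cantor_nums M w 0 = {0}"
| "cantor_nums M w (Suc j) =
    (\<Union>n\<in>cantor_nums M w j. (\<lambda>a. n * M + a) ` w (Suc j) (card {m \<in> cantor_nums M w j. m < n}))"

lemma cantor_nums_cong:
  assumes "\<And>i. 1 \<le> i \<Longrightarrow> i \<le> j \<Longrightarrow> w i = w' i"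
  shows "cantor_nums M w j = cantor_nums M w' j"
  using assms
proof (induction j)
  case (Suc j)
  then have "cantor_nums M w j = cantor_nums M w' j" by simp
  with Suc.prems[of "Suc j"] show ?case by simp
qed auto

lemma cantor_points_eq_image:
  assumes "0 < M"
  shows "cantor_points M w j = (\<lambda>n. real n / real M ^ j) ` cantor_nums M w j"
proof (induction j)
  case (Suc j)
  let ?P = "cantor_nums M w j" and ?f = "\<lambda>n. real n / real M ^ j"
  have M0: "real M ^ j > 0" using assms by simp
  have rank: "card {c \<in> ?f ` ?P. c < ?f n} = card {m \<in> ?P. m < n}" for n
  proof -
    have "{c \<in> ?f ` ?P. c < ?f n} = ?f ` {m \<in> ?P. m < n}"
      using M0 by (auto simp: divide_strict_right_mono field_simps)
    moreover have "inj_on ?f {m \<in> ?P. m < n}"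
      using M0 by (auto intro!: inj_onI)
    ultimately show ?thesis by (simp add: card_image)
  qed
  have 1: "?f n + real a / real M ^ Suc j = real (n * M + a) / real M ^ Suc j" for n a
    using assms by (simp add: field_simps)
  show ?case
    unfolding cantor_points.simps cantor_nums.simps Suc.IH image_UN image_image UN_extend_simps
      rank 1
    by (auto simp: image_iff)
qed auto

text \<open>Used to see that rank selection hands every alphabet of a step to exactly one point, so
  sums over points can be reindexed by alphabet numbers.\<close>

lemma bij_betw_rank:
  fixes P :: "'a::linorder set"
  assumes "finite P"
  shows "bij_betw (\<lambda>n. card {m \<in> P. m < n}) P {..<card P}"
proof -
  let ?r = "\<lambda>n. card {m \<in> P. m < n}"
  have mono: "?r n < ?r n'" if "n \<in> P" "n' \<in> P" "n < n'" for n n'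
    by (rule psubset_card_mono) (use assms that in auto)
  have inj: "inj_on ?r P"
  proof (rule inj_onI)
    fix x y assume "x \<in> P" "y \<in> P" "?r x = ?r y"
    then show "x = y" using mono[of x y] mono[of y x] by (cases x y rule: linorder_cases) auto
  qed
  have "?r ` P \<subseteq> {..<card P}"
    using assms by (auto intro!: psubset_card_mono)
  moreover have "card (?r ` P) = card {..<card P}" using inj by (simp add: card_image)
  ultimately have "?r ` P = {..<card P}" by (intro card_subset_eq) auto
  with inj show ?thesis by (simp add: bij_betw_def)
qed

text \<open>The deterministic side: one fixed outcome. Stage \<open>j\<close> has A^j points, and
  these consume the alphabets of step \<open>Suc j\<close>.\<close>

locale cantor_choice =
  fixes M A :: nat and w :: "nat \<Rightarrow> nat \<Rightarrow> nat set"
  assumes M2: "2 \<le> M" and A0: "0 < A"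
    and choice: "\<And>j k. k < A ^ j \<Longrightarrow> w (Suc j) k \<in> alphabets M A"
begin

abbreviation "P \<equiv> cantor_nums M w"
abbreviation "alph j n \<equiv> w (Suc j) (card {m \<in> cantor_nums M w j. m < n})"

lemma M0: "0 < M" using M2 by simp

text \<open>The hypotheses on \<open>P j\<close> are what \<open>nums\<close> establishes by
  induction. This lemma and the next are needed inside that induction; \<open>alph\<close> and
  \<open>sum_nums_Suc\<close> are their final forms.\<close>

lemma alph_if_card:
  assumes "finite (P j)" "card (P j) = A ^ j" "n \<in> P j"
  shows "alph j n \<in> alphabets M A"
  using bij_betwE[OF bij_betw_rank[OF assms(1)]] assms by (intro choice) auto

lemma sum_nums_Suc_if_card:
  assumes P: "finite (P j)" "card (P j) = A ^ j"
  shows "(\<Sum>m\<in>P (Suc j). F m :: 'b::comm_monoid_add) = (\<Sum>n\<in>P j. \<Sum>a\<in>alph j n. F (n * M + a))"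
proof -
  have fin: "finite (alph j n)" if "n \<in> P j" for n
    using alph_if_card[OF P that] by (auto simp: alphabets_def finite_subset)
  have sub: "a < M" if "n \<in> P j" "a \<in> alph j n" for n a
    using alph_if_card[OF P that(1)] that(2) by (auto simp: alphabets_def)
  have disj: "(\<lambda>a. n * M + a) ` alph j n \<inter> (\<lambda>a. n' * M + a) ` alph j n' = {}"
    if "n \<in> P j" "n' \<in> P j" "n \<noteq> n'" for n n'
  proof (rule ccontr)
    assume "\<not> ?thesis"
    then obtain a a' where a: "a \<in> alph j n" "a' \<in> alph j n'" "n * M + a = n' * M + a'" by auto
    have "a < M" "a' < M" using a that sub by auto
    then have "(n * M + a) div M = n" "(n' * M + a') div M = n'" by simp_all
    with a that show False by simp
  qed
  have "(\<Sum>m\<in>P (Suc j). F m) = (\<Sum>n\<in>P j. \<Sum>m\<in>(\<lambda>a. n * M + a) ` alph j n. F m)"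
    unfolding cantor_nums.simps using P fin disj by (intro sum.UNION_disjoint) auto
  also have "\<dots> = (\<Sum>n\<in>P j. \<Sum>a\<in>alph j n. F (n * M + a))"
    by (intro sum.cong refl sum.reindex_cong[of "\<lambda>a. _ * M + a"] inj_onI) auto
  finally show ?thesis .
qed

lemma nums: "finite (P j) \<and> card (P j) = A ^ j \<and> P j \<subseteq> {..<M ^ j}"
proof (induction j)
  case (Suc j)
  then have P: "finite (P j)" "card (P j) = A ^ j" by auto
  have fin: "finite (alph j n)" if "n \<in> P j" for n
    using alph_if_card[OF P that] by (auto simp: alphabets_def finite_subset)
  then have "finite (P (Suc j))" using P by auto
  moreover have "card (P (Suc j)) = A ^ Suc j"
  proof -
    have "card (P (Suc j)) = (\<Sum>m\<in>P (Suc j). 1)" by simp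
    also have "\<dots> = (\<Sum>n\<in>P j. A)"
      unfolding sum_nums_Suc_if_card[OF P] using alph_if_card[OF P]
      by (intro sum.cong) (auto simp: alphabets_def)
    finally show ?thesis using P by simp
  qed
  moreover have "P (Suc j) \<subseteq> {..<M ^ Suc j}"
  proof
    fix m assume "m \<in> P (Suc j)"
    then obtain n a where m: "m = n * M + a" "n \<in> P j" "a \<in> alph j n" by auto
    have "a < M" using alph_if_card[OF P m(2)] m(3) by (auto simp: alphabets_def)
    moreover have "Suc n \<le> M ^ j" using Suc m by auto
    then have "Suc n * M \<le> M ^ j * M" by (intro mult_le_mono) auto
    ultimately show "m \<in> {..<M ^ Suc j}" using m by (simp add: mult.commute)
  qed
  ultimately show ?case by blast
qed auto

lemma finite_nums: "finite (P j)" and card_nums: "card (P j) = A ^ j"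
  and nums_less: "n \<in> P j \<Longrightarrow> n < M ^ j"
  using nums[of j] by auto

lemmas alph = alph_if_card[OF finite_nums card_nums]
lemmas sum_nums_Suc = sum_nums_Suc_if_card[OF finite_nums card_nums]

text \<open>\<open>n div M ^ (J - i)\<close> deletes the last \<open>J - i\<close> digits, hence is
  the ancestor of \<open>n\<close> at stage \<open>i\<close>; each point of stage \<open>i\<close>
  has A^(J-i) descendants at stage \<open>J\<close>.\<close>

lemma sum_ancestors:
  assumes "i \<le> J"
  shows "(\<Sum>n\<in>P J. F (n div M ^ (J - i))) = of_nat (A ^ (J - i)) * (\<Sum>m\<in>P i. F m :: real)"
  using assms
proof (induction J rule: dec_induct)
  case base
  then show ?case by simp
next
  case (step J)
  have "(\<Sum>n\<in>P (Suc J). F (n div M ^ (Suc J - i)))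
      = (\<Sum>n\<in>P J. \<Sum>a\<in>alph J n. F ((n * M + a) div M ^ (Suc J - i)))"
    by (rule sum_nums_Suc)
  also have "\<dots> = (\<Sum>n\<in>P J. real A * F (n div M ^ (J - i)))"
  proof (rule sum.cong[OF refl])
    fix n assume n: "n \<in> P J"
    have "(\<Sum>a\<in>alph J n. F ((n * M + a) div M ^ (Suc J - i)))
        = (\<Sum>a\<in>alph J n. F (n div M ^ (J - i)))"
    proof (rule sum.cong[OF refl])
      fix a assume "a \<in> alph J n"
      then have "a < M" using alph[OF n] by (auto simp: alphabets_def)
      then have "(n * M + a) div M = n" by simp
      then show "F ((n * M + a) div M ^ (Suc J - i)) = F (n div M ^ (J - i))"
        using step(1) by (simp add: Suc_diff_le div_mult2_eq)
    qed
    then show "(\<Sum>a\<in>alph J n. F ((n * M + a) div M ^ (Suc J - i))) = real A * F (n div M ^ (J - i))"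
      using alph[OF n] by (simp add: alphabets_def)
  qed
  finally show ?case using step by (simp add: sum_distrib_left[symmetric] Suc_diff_le)
qed

end

section \<open>Fourier transforms of the stage measures\<close>

lemma cmod_iexp_diff_1: "cmod (iexp x - 1) \<le> \<bar>x\<bar>"
  using iexp_approx1[of x 0] by simp

lemma iexp_add: "iexp (x + y) = iexp x * iexp y"
  by (simp add: distrib_left exp_add)

text \<open>The characteristic function of the uniform law on [0,1], except at 0, where division by
  zero gives 0 in place of 1; hence the assumption of a nonzero argument below.\<close>

definition sinc_exp :: "real \<Rightarrow> complex" where
  "sinc_exp s = (iexp s - 1) / (\<i> * of_real s)"

lemma cmod_sinc_exp:
  assumes "s \<noteq> 0"
  shows "cmod (sinc_exp s) \<le> 1" "cmod (sinc_exp s) \<le> 2 / \<bar>s\<bar>"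
proof -
  have "cmod (sinc_exp s) = cmod (iexp s - 1) / \<bar>s\<bar>"
    by (simp add: sinc_exp_def norm_divide norm_mult)
  moreover have "cmod (iexp s - 1) \<le> 2"
    using norm_triangle_ineq4[of "iexp s" 1] by simp
  ultimately show "cmod (sinc_exp s) \<le> 1" "cmod (sinc_exp s) \<le> 2 / \<bar>s\<bar>"
    using cmod_iexp_diff_1[of s] assms by (simp_all add: divide_right_mono)
qed

text \<open>An interval of length \<open>M\<close> consists of \<open>M\<close> unit intervals, so
  its transform is that of one unit interval times a geometric sum of phases.\<close>

lemma sinc_exp_mult:
  assumes "0 < M" "s \<noteq> 0"
  shows "of_nat M * sinc_exp (real M * s) = sinc_exp s * (\<Sum>a<M. iexp (s * real a))"
proof -
  have "iexp (s * real a) = iexp s ^ a" for a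
    by (simp add: exp_of_nat_mult[symmetric] mult.commute mult.left_commute)
  then have "(iexp s - 1) * (\<Sum>a<M. iexp (s * real a)) = iexp s ^ M - 1"
    by (simp add: power_diff_1_eq)
  also have "iexp s ^ M = iexp (real M * s)"
    by (simp add: exp_of_nat_mult[symmetric] mult.left_commute)
  finally have "(iexp s - 1) * (\<Sum>a<M. iexp (s * real a)) = iexp (real M * s) - 1" .
  then have "of_nat M * sinc_exp (real M * s)
      = of_nat M * ((iexp s - 1) * (\<Sum>a<M. iexp (s * real a)) / (\<i> * of_real (real M * s)))"
    unfolding sinc_exp_def by simp
  also have "\<dots> = (iexp s - 1) * (\<Sum>a<M. iexp (s * real a)) / (\<i> * of_real s)"
    using assms by simp
  finally show ?thesis by (simp add: sinc_exp_def)
qed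

lemma set_integral_iexp:
  assumes "t \<noteq> 0" "a \<le> b"
  shows "(CLBINT x:{a..<b}. iexp (t * x)) = (iexp (t * b) - iexp (t * a)) / (\<i> * of_real t)"
proof -
  have "(CLBINT x=a..b. iexp (t * x)) = iexp (t * b) / (\<i> * of_real t) - iexp (t * a) / (\<i> * of_real t)"
  proof (rule interval_integral_FTC_finite)
    fix x
    have "((\<lambda>x. iexp (t * x)) has_vector_derivative (\<i> * of_real t * iexp (t * x))) (at x within {min a b..max a b})"
      by (auto intro!: derivative_eq_intros simp: Re_exp Im_exp has_vector_derivative_complex_iff)
    from has_vector_derivative_divide[OF this, of "\<i> * of_real t"]
    show "((\<lambda>x. iexp (t * x) / (\<i> * of_real t)) has_vector_derivative iexp (t * x)) (at x within {min a b..max a b})"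
      using assms by simp
  qed (auto intro!: continuous_intros)
  then show ?thesis
    using assms by (simp add: interval_integral_Ico diff_divide_distrib)
qed

text \<open>The random part of step \<open>Suc j\<close>: every alphabet sum is centred by its mean,
  which is \<open>A / M\<close> times the sum over all digits. Given the first \<open>j\<close>
  steps, it has mean zero.\<close>

definition step_sum :: "nat \<Rightarrow> nat \<Rightarrow> (nat \<Rightarrow> nat \<Rightarrow> nat set) \<Rightarrow> nat \<Rightarrow> real \<Rightarrow> complex" where
  "step_sum M A w j t = (\<Sum>n\<in>cantor_nums M w j. iexp (t * real n / real M ^ j) *
      ((\<Sum>a\<in>w (Suc j) (card {m \<in> cantor_nums M w j. m < n}). iexp (t * real a / real M ^ Suc j))
        - of_nat A / of_nat M * (\<Sum>a<M. iexp (t * real a / real M ^ Suc j)))) / of_nat A ^ Suc j"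

section \<open>Stage measures as sums over cells\<close>

context cantor_choice
begin

text \<open>Half-open, unlike the intervals of \<open>cantor_stage\<close>, so that cells are
  disjoint and a floor tells which cell contains a point.\<close>

abbreviation "cell j n \<equiv> {real n / real M ^ j..<(real n + 1) / real M ^ j}"

lemma Mj0: "0 < real M ^ j" using M0 by simp

lemma mem_cell_iff: "x \<in> cell j n \<longleftrightarrow> 0 \<le> x \<and> n = nat \<lfloor>x * real M ^ j\<rfloor>"
proof -
  have "x \<in> cell j n \<longleftrightarrow> real n \<le> x * real M ^ j \<and> x * real M ^ j < real n + 1"
    using Mj0[of j] by (auto simp: field_simps)
  also have "\<dots> \<longleftrightarrow> \<lfloor>x * real M ^ j\<rfloor> = int n" by (auto simp: floor_eq_iff)
  also have "\<dots> \<longleftrightarrow> 0 \<le> x \<and> n = nat \<lfloor>x * real M ^ j\<rfloor>"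
  proof -
    have "0 \<le> x \<longleftrightarrow> 0 \<le> x * real M ^ j" using Mj0[of j]
      by (metis mult_neg_pos mult_nonneg_nonneg not_le order_less_imp_le)
    then have "0 \<le> x \<longleftrightarrow> 0 \<le> \<lfloor>x * real M ^ j\<rfloor>" by simp
    then show ?thesis by linarith
  qed
  finally show ?thesis .
qed

lemma cell_subset:
  assumes "n \<in> P j"
  shows "cell j n \<subseteq> {0..<1}"
proof
  fix x assume "x \<in> cell j n"
  then have "real n / real M ^ j \<le> x" "x < (real n + 1) / real M ^ j" by auto
  moreover have "real (Suc n) \<le> real (M ^ j)" using nums_less[OF assms] by (intro of_nat_mono) simp
  then have "(real n + 1) / real M ^ j \<le> 1" using Mj0[of j] by simp
  moreover have "0 \<le> real n / real M ^ j" by simp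
  ultimately show "x \<in> {0..<1}" unfolding atLeastLessThan_iff by linarith
qed

lemma stage_measure_eq:
  "stage_measure M A w j =
    density lborel (\<lambda>x. ennreal (real M ^ j / real A ^ j * (\<Sum>n\<in>P j. indicator (cell j n) x)))"
  unfolding stage_measure_def
proof (rule density_cong)
  have stage: "cantor_stage M w j = (\<Union>n\<in>P j. {real n / real M ^ j..(real n + 1) / real M ^ j})"
    by (simp add: cantor_stage_def cantor_points_eq_image[OF M0] add_divide_distrib)
  show "(\<lambda>x. ennreal (real M ^ j / real A ^ j * indicator (cantor_stage M w j) x)) \<in> borel_measurable lborel"
    unfolding stage using finite_nums by (auto intro!: measurable_compose[OF _ measurable_ennreal] borel_measurable_times borel_measurable_indicator)
  have sum: "(\<Sum>n\<in>P j. indicator (cell j n) x) = (indicator (\<Union>n\<in>P j. cell j n) x :: real)" for x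
  proof (rule indicator_UN_disjoint[symmetric])
    show "disjoint_family_on (cell j) (P j)"
      unfolding disjoint_family_on_def by (metis disjoint_iff mem_cell_iff)
  qed (rule finite_nums)
  \<comment> \<open>Closed intervals and cells differ only in right endpoints, which are finitely
    many and so Lebesgue null.\<close>
  have "AE x in lborel. \<forall>n\<in>P j. x \<noteq> (real n + 1) / real M ^ j"
    using finite_nums by (intro AE_finite_allI AE_lborel_singleton)
  then show "AE x in lborel. ennreal (real M ^ j / real A ^ j * indicator (cantor_stage M w j) x)
      = ennreal (real M ^ j / real A ^ j * (\<Sum>n\<in>P j. indicator (cell j n) x))"
  proof eventually_elim
    case (elim x)
    then have "x \<in> cantor_stage M w j \<longleftrightarrow> x \<in> (\<Union>n\<in>P j. cell j n)"
      unfolding stage by force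
    then show ?case unfolding sum by (simp add: indicator_def)
  qed
qed auto

lemma sets_stage [simp, measurable_cong]: "sets (stage_measure M A w j) = sets borel"
  by (simp add: stage_measure_eq)

text \<open>A general \<open>B\<close> serves two purposes: \<open>UNIV\<close> gives total mass 1,
  and \<open>{-1<..1}\<close> gives tightness in \<open>Ex_weak_limit\<close>.\<close>

lemma emeasure_stage:
  assumes "B \<in> sets borel" "{0..<1} \<subseteq> B"
  shows "emeasure (stage_measure M A w j) B = 1"
proof -
  let ?c = "real M ^ j / real A ^ j"
  have sub: "x \<in> B" if "n \<in> P j" "x \<in> cell j n" for n x
    using cell_subset[OF that(1)] that(2) assms(2) by blast
  have "emeasure (stage_measure M A w j) B
      = (\<integral>\<^sup>+x. ennreal (?c * (\<Sum>n\<in>P j. indicator (cell j n) x)) * indicator B x \<partial>lborel)"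
    unfolding stage_measure_eq using assms by (intro emeasure_density) auto
  also have "\<dots> = (\<integral>\<^sup>+x. (\<Sum>n\<in>P j. ennreal ?c * indicator (cell j n) x) \<partial>lborel)"
  proof (rule nn_integral_cong)
    fix x
    have "ennreal (?c * (\<Sum>n\<in>P j. indicator (cell j n) x)) * indicator B x
       = ennreal ?c * (\<Sum>n\<in>P j. ennreal (indicator (cell j n) x)) * indicator B x"
      by (subst ennreal_mult') (simp_all add: sum_nonneg)
    also have "\<dots> = (\<Sum>n\<in>P j. ennreal ?c * indicator (cell j n) x * indicator B x)"
      by (simp add: sum_distrib_left sum_distrib_right ennreal_indicator)
    also have "\<dots> = (\<Sum>n\<in>P j. ennreal ?c * indicator (cell j n) x)"
      using sub by (intro sum.cong refl) (auto simp: indicator_def)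
    finally show "ennreal (?c * (\<Sum>n\<in>P j. indicator (cell j n) x)) * indicator B x
       = (\<Sum>n\<in>P j. ennreal ?c * indicator (cell j n) x)" .
  qed
  also have "\<dots> = (\<Sum>n\<in>P j. ennreal ?c * emeasure lborel (cell j n))"
    by (simp add: nn_integral_sum nn_integral_cmult)
  also have "\<dots> = (\<Sum>n\<in>P j. ennreal (1 / real A ^ j))"
  proof (rule sum.cong[OF refl])
    fix n
    have "(real n + 1) / real M ^ j - real n / real M ^ j = 1 / real M ^ j"
      by (simp add: diff_divide_distrib[symmetric])
    then show "ennreal ?c * emeasure lborel (cell j n) = ennreal (1 / real A ^ j)"
      using Mj0[of j] by (simp add: divide_right_mono ennreal_mult'[symmetric])
  qed
  also have "\<dots> = ennreal (\<Sum>n\<in>P j. 1 / real A ^ j)"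
    by (rule sum_ennreal) simp
  also have "\<dots> = 1" using A0 by (simp add: card_nums)
  finally show ?thesis .
qed

lemma real_distribution_stage: "real_distribution (stage_measure M A w j)"
proof -
  interpret prob_space "stage_measure M A w j"
  proof
    show "emeasure (stage_measure M A w j) (space (stage_measure M A w j)) = 1"
      using emeasure_stage[of UNIV j] sets_eq_imp_space_eq[OF sets_stage[of j]] by simp
  qed
  show ?thesis by unfold_locales simp
qed

lemma integral_stage:
  fixes f :: "real \<Rightarrow> 'b::{banach, second_countable_topology}"
  assumes [measurable]: "f \<in> borel_measurable borel" and bd: "\<And>x. norm (f x) \<le> B"
  shows "integral\<^sup>L (stage_measure M A w j) f
    = (real M ^ j / real A ^ j) *\<^sub>R (\<Sum>n\<in>P j. (LBINT x:cell j n. f x))"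
proof -
  let ?c = "real M ^ j / real A ^ j"
  have int: "set_integrable lborel (cell j n) f" for n
    unfolding set_integrable_def
  proof (rule Bochner_Integration.integrable_bound)
    show "integrable lborel (\<lambda>x. B * indicator (cell j n) x :: real)"
      by (intro integrable_mult_right integrable_real_indicator)
        (auto simp: divide_right_mono)
    show "AE x in lborel. norm (indicat_real (cell j n) x *\<^sub>R f x) \<le> norm (B * indicator (cell j n) x :: real)"
      using bd order_trans[OF bd abs_ge_self] by (auto simp: indicator_def)
  qed auto
  have "integral\<^sup>L (stage_measure M A w j) f
      = (LBINT x. (?c * (\<Sum>n\<in>P j. indicator (cell j n) x)) *\<^sub>R f x)"
    unfolding stage_measure_eq by (intro integral_density) (auto intro!: AE_I2 sum_nonneg divide_nonneg_nonneg mult_nonneg_nonneg)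
  also have "\<dots> = (LBINT x. ?c *\<^sub>R (\<Sum>n\<in>P j. indicator (cell j n) x *\<^sub>R f x))"
    by (intro Bochner_Integration.integral_cong refl) (simp only: scaleR_scaleR[symmetric] scaleR_sum_left)
  also have "\<dots> = ?c *\<^sub>R (LBINT x. \<Sum>n\<in>P j. indicator (cell j n) x *\<^sub>R f x)"
    by (rule integral_scaleR_right)
  also have "\<dots> = ?c *\<^sub>R (\<Sum>n\<in>P j. (LBINT x:cell j n. f x))"
    using int by (simp add: set_lebesgue_integral_def set_integrable_def)
  finally show ?thesis .
qed

text \<open>Every cell of stage \<open>j\<close> carries mass A^(-j), so a bound that is constant on
  each cell is enough.\<close>

lemma integral_stage_le:
  fixes f :: "real \<Rightarrow> real"
  assumes [measurable]: "f \<in> borel_measurable borel" and bd: "\<And>x. \<bar>f x\<bar> \<le> B"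
    and U: "\<And>n x. n \<in> P j \<Longrightarrow> x \<in> cell j n \<Longrightarrow> f x \<le> U n"
  shows "integral\<^sup>L (stage_measure M A w j) f \<le> (\<Sum>n\<in>P j. U n) / real A ^ j"
proof -
  have fin: "emeasure lborel (cell j n) < \<infinity>" for n by (simp add: divide_right_mono)
  have len: "measure lborel (cell j n) = 1 / real M ^ j" for n
    by (simp add: divide_right_mono diff_divide_distrib[symmetric])
  have "(LBINT x:cell j n. f x) \<le> U n / real M ^ j" if n: "n \<in> P j" for n
  proof -
    have "(LBINT x:cell j n. f x) \<le> (LBINT x:cell j n. U n)"
    proof (rule set_integral_mono)
      show "set_integrable lborel (cell j n) f"
        unfolding set_integrable_def
      proof (rule Bochner_Integration.integrable_bound)
        show "integrable lborel (\<lambda>x. B * indicator (cell j n) x :: real)"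
          using fin by (intro integrable_mult_right integrable_real_indicator) auto
        show "AE x in lborel. norm (indicat_real (cell j n) x *\<^sub>R f x) \<le> norm (B * indicator (cell j n) x :: real)"
          using order_trans[OF bd abs_ge_self] by (auto simp: indicator_def)
      qed auto
      show "set_integrable lborel (cell j n) (\<lambda>x. U n)"
        using fin by (auto simp: set_integrable_def)
      show "\<And>x. x \<in> cell j n \<Longrightarrow> f x \<le> U n" using U n by blast
    qed
    also have "\<dots> = U n / real M ^ j"
      by (simp add: set_lebesgue_integral_def len)
    finally show ?thesis .
  qed
  then have "(\<Sum>n\<in>P j. (LBINT x:cell j n. f x)) \<le> (\<Sum>n\<in>P j. U n / real M ^ j)"
    by (intro sum_mono)
  then have "real M ^ j / real A ^ j * (\<Sum>n\<in>P j. (LBINT x:cell j n. f x))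
      \<le> real M ^ j / real A ^ j * ((\<Sum>n\<in>P j. U n) / real M ^ j)"
    by (intro mult_left_mono) (auto simp: sum_divide_distrib)
  also have "\<dots> = (\<Sum>n\<in>P j. U n) / real A ^ j" using Mj0[of j] by simp
  finally show ?thesis using integral_stage[of f B j] bd by simp
qed

lemma char_stage:
  assumes "t \<noteq> 0"
  shows "char (stage_measure M A w j) t
    = sinc_exp (t / real M ^ j) * (\<Sum>n\<in>P j. iexp (t * real n / real M ^ j)) / of_nat A ^ j"
proof -
  have 1: "(CLBINT x:cell j n. iexp (t * x))
      = sinc_exp (t / real M ^ j) * iexp (t * real n / real M ^ j) / of_nat M ^ j" for n
  proof -
    have "(CLBINT x:cell j n. iexp (t * x))
        = (iexp (t * ((real n + 1) / real M ^ j)) - iexp (t * (real n / real M ^ j))) / (\<i> * of_real t)"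
      using assms by (intro set_integral_iexp) (auto simp: divide_right_mono)
    also have "t * ((real n + 1) / real M ^ j) = t * real n / real M ^ j + t / real M ^ j"
      by (simp add: distrib_left add_divide_distrib)
    finally have "(CLBINT x:cell j n. iexp (t * x))
        = (iexp (t / real M ^ j) - 1) * iexp (t * real n / real M ^ j) / (\<i> * of_real t)"
      unfolding iexp_add by (simp add: algebra_simps)
    then show ?thesis
      using assms M0 unfolding sinc_exp_def by simp
  qed
  have "char (stage_measure M A w j) t
      = (real M ^ j / real A ^ j) *\<^sub>R (\<Sum>n\<in>P j. (CLBINT x:cell j n. iexp (t * x)))"
    unfolding char_def by (rule integral_stage[where B = 1]) auto
  then show ?thesis
    unfolding 1 using M0 by (simp add: scaleR_conv_of_real sum_distrib_left sum_divide_distrib)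
qed

lemma iexp_child:
  "iexp (t * real (n * M + a) / real M ^ Suc j)
    = iexp (t * real n / real M ^ j) * iexp (t * real a / real M ^ Suc j)"
proof -
  have "t * real (n * M + a) / real M ^ Suc j = t * real n / real M ^ j + t * real a / real M ^ Suc j"
    using M0 by (simp add: field_simps)
  then show ?thesis by (simp only: iexp_add)
qed

lemma step_sum_eq:
  "step_sum M A w j t = (\<Sum>n\<in>P j. (\<Sum>a\<in>alph j n. iexp (t * real (n * M + a) / real M ^ Suc j))
      - of_nat A / of_nat M * (\<Sum>a<M. iexp (t * real (n * M + a) / real M ^ Suc j))) / of_nat A ^ Suc j"
  unfolding step_sum_def iexp_child
  by (simp only: sum_distrib_left[symmetric] right_diff_distrib mult.left_commute)

text \<open>Splitting cells into \<open>M\<close> children by \<open>sinc_exp_mult\<close> writes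
  the transform of stage \<open>j\<close> as that of stage \<open>Suc j\<close> with every alphabet
  sum replaced by its mean. The difference is the centred sum times the transform of one child
  cell.\<close>

lemma char_stage_Suc:
  assumes "t \<noteq> 0"
  shows "char (stage_measure M A w (Suc j)) t
    = char (stage_measure M A w j) t + sinc_exp (t / real M ^ Suc j) * step_sum M A w j t"
proof -
  let ?s = "t / real M ^ Suc j"
  let ?E = "\<lambda>n. iexp (t * real n / real M ^ j)" and ?F = "\<lambda>a. iexp (t * real a / real M ^ Suc j)"
  have "sinc_exp (t / real M ^ j) = sinc_exp (real M * ?s)" using M0 by simp
  also have "\<dots> = sinc_exp ?s * (\<Sum>a<M. iexp (?s * real a)) / of_nat M"
    using sinc_exp_mult[OF M0, of ?s] assms M0 by (simp add: field_simps)
  finally have 1: "sinc_exp (t / real M ^ j) = sinc_exp ?s * (\<Sum>a<M. ?F a) / of_nat M" by simp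
  have "char (stage_measure M A w (Suc j)) t
      = sinc_exp ?s * (\<Sum>n\<in>P j. \<Sum>a\<in>alph j n. ?E n * ?F a) / of_nat A ^ Suc j"
    unfolding char_stage[OF assms] sum_nums_Suc iexp_child ..
  moreover have "char (stage_measure M A w j) t
      = sinc_exp ?s * (\<Sum>n\<in>P j. ?E n * (of_nat A / of_nat M * (\<Sum>a<M. ?F a))) / of_nat A ^ Suc j"
    unfolding char_stage[OF assms] 1 sum_distrib_right[symmetric] using A0 M0
    by simp
  ultimately show ?thesis
    unfolding step_sum_def
    by (simp add: sum_distrib_left[symmetric] right_diff_distrib sum_subtractf diff_divide_distrib)
qed

text \<open>Valid for every outcome, and enough for the transforms to converge at each fixed
  \<open>t\<close>: the digits of one step move the phase by at most |t| / M^j.\<close>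

lemma cmod_step_sum_le: "cmod (step_sum M A w j t) \<le> 2 * \<bar>t\<bar> / real M ^ j"
proof -
  let ?F = "\<lambda>a. iexp (t * real a / real M ^ Suc j)"
  have F: "cmod (?F a - 1) \<le> \<bar>t\<bar> / real M ^ j" if "a < M" for a
  proof -
    have "cmod (?F a - 1) \<le> \<bar>t\<bar> * real a / real M ^ Suc j"
      using cmod_iexp_diff_1[of "t * real a / real M ^ Suc j"] by (simp add: abs_mult)
    also have "\<dots> \<le> \<bar>t\<bar> * real M / real M ^ Suc j"
      using that by (intro divide_right_mono mult_left_mono) auto
    also have "\<dots> = \<bar>t\<bar> / real M ^ j" using M0 by simp
    finally show ?thesis .
  qed
  have bound: "cmod (iexp (t * real n / real M ^ j) * ((\<Sum>a\<in>alph j n. ?F a)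
        - of_nat A / of_nat M * (\<Sum>a<M. ?F a))) \<le> 2 * real A * \<bar>t\<bar> / real M ^ j" if n: "n \<in> P j" for n
  proof -
    have al: "alph j n \<subseteq> {..<M}" "card (alph j n) = A" using alph[OF n] by (auto simp: alphabets_def)
    \<comment> \<open>Both sums have total weight \<open>A\<close>, so 1 can be subtracted from
      every exponential.\<close>
    have eq: "(\<Sum>a\<in>alph j n. ?F a) - of_nat A / of_nat M * (\<Sum>a<M. ?F a)
        = (\<Sum>a\<in>alph j n. ?F a - 1) - of_nat A / of_nat M * (\<Sum>a<M. ?F a - 1)"
      using M0 by (simp add: sum_subtractf al right_diff_distrib)
    have "cmod (\<Sum>a\<in>alph j n. ?F a - 1) \<le> real A * (\<bar>t\<bar> / real M ^ j)"
    proof -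
      have "cmod (\<Sum>a\<in>alph j n. ?F a - 1) \<le> (\<Sum>a\<in>alph j n. \<bar>t\<bar> / real M ^ j)"
      proof (rule order_trans[OF norm_sum sum_mono])
        fix a assume "a \<in> alph j n"
        then show "cmod (?F a - 1) \<le> \<bar>t\<bar> / real M ^ j" using al(1) by (intro F) auto
      qed
      then show ?thesis using al by simp
    qed
    moreover have "cmod (of_nat A / of_nat M * (\<Sum>a<M. ?F a - 1)) \<le> real A / real M * (real M * (\<bar>t\<bar> / real M ^ j))"
    proof -
      have "cmod (\<Sum>a<M. ?F a - 1) \<le> (\<Sum>a<M. \<bar>t\<bar> / real M ^ j)"
        by (rule order_trans[OF norm_sum sum_mono]) (blast intro: F)
      then have "cmod (\<Sum>a<M. ?F a - 1) \<le> real M * (\<bar>t\<bar> / real M ^ j)" by simp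
      then show ?thesis
        unfolding norm_mult norm_divide norm_of_nat by (intro mult_left_mono) auto
    qed
    ultimately have "cmod ((\<Sum>a\<in>alph j n. ?F a - 1) - of_nat A / of_nat M * (\<Sum>a<M. ?F a - 1))
        \<le> real A * (\<bar>t\<bar> / real M ^ j) + real A / real M * (real M * (\<bar>t\<bar> / real M ^ j))"
      by (intro order_trans[OF norm_triangle_ineq4] add_mono)
    also have "\<dots> = 2 * real A * \<bar>t\<bar> / real M ^ j" using M0 by simp
    finally show ?thesis unfolding eq norm_mult norm_exp_i_times by simp
  qed
  have "cmod (step_sum M A w j t) \<le> (\<Sum>n\<in>P j. 2 * real A * \<bar>t\<bar> / real M ^ j) / real A ^ Suc j"
    unfolding step_sum_def norm_divide norm_power norm_of_nat
    by (intro divide_right_mono order_trans[OF norm_sum sum_mono] bound) auto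
  also have "\<dots> = 2 * \<bar>t\<bar> / real M ^ j"
    using A0 by (simp add: card_nums)
  finally show ?thesis .
qed

end

section \<open>The Cantor measure and its Fourier decay\<close>

lemma sum_two_sided_geometric_le:
  "(\<Sum>i<N. if i \<le> k then (1/2) ^ (k - i) else (1/2) ^ (i - Suc k) :: real) \<le> 4"
proof -
  let ?g = "\<lambda>i. if i \<le> k then (1/2) ^ (k - i) else (1/2) ^ (i - Suc k) :: real"
  have geo: "(\<Sum>i<n. (1/2) ^ i :: real) \<le> 2" for n
    using sum_le_suminf[of "\<lambda>i. (1/2::real) ^ i" "{..<n}"] by (simp add: suminf_geometric)
  have "(\<Sum>i<N. ?g i) \<le> (\<Sum>i<Suc k + N. ?g i)"
    by (rule sum_mono2) auto
  also have "\<dots> = (\<Sum>i<Suc k. ?g i) + (\<Sum>i<N. ?g (Suc k + i))"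
    by (induction N) auto
  also have "(\<Sum>i<Suc k. ?g i) = (\<Sum>i<Suc k. (1/2) ^ (Suc k - Suc i))"
    by (intro sum.cong) auto
  also have "\<dots> = (\<Sum>i<Suc k. (1/2) ^ i :: real)"
    by (rule sum.nat_diff_reindex)
  also have "(\<Sum>i<N. ?g (Suc k + i)) = (\<Sum>i<N. (1/2) ^ i :: real)"
    by (intro sum.cong) auto
  finally show ?thesis using geo[of "Suc k"] geo[of N] by linarith
qed

text \<open>Let M^k \<le> t \<le> M^(k+1). For i \<le> k the first factor gives 2 t^(-\<alpha>) (M^i
  / t)^(1-\<alpha>), where 1 - \<alpha> \<ge> \<alpha>; for i > k the second factor alone suffices.
  On both sides the terms at least halve per step because M^\<alpha> \<ge> 2, so the constant 8 = 2
  * 4 does not depend on \<open>M\<close>.\<close>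

lemma sum_min_powr_le:
  fixes \<alpha> t M :: real
  assumes M: "1 < M" and a: "0 < \<alpha>" "\<alpha> \<le> 1/2" "2 \<le> M powr \<alpha>" and t: "1 \<le> t"
  shows "(\<Sum>i<N. min 1 (2 * M ^ i / t) * (M powr (-\<alpha>)) ^ i) \<le> 8 * t powr (-\<alpha>)"
proof -
  define k where "k = nat \<lfloor>log M t\<rfloor>"
  have "0 \<le> log M t" using M t by (simp add: zero_le_log_cancel_iff)
  then have "real k \<le> log M t" "log M t \<le> real (Suc k)"
    unfolding k_def by linarith+
  then have "M powr real k \<le> M powr log M t" "M powr log M t \<le> M powr real (Suc k)"
    using M by (simp_all del: of_nat_Suc)
  then have k: "M ^ k \<le> t" "t \<le> M ^ Suc k"
    using M t by (simp_all add: powr_realpow del: of_nat_Suc power_Suc)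
  have half: "(M powr (-\<alpha>)) ^ m \<le> (1/2) ^ m" for m
    using le_imp_inverse_le[OF a(3)] by (intro power_mono) (simp_all add: powr_minus)
  have "min 1 (2 * M ^ i / t) * (M powr (-\<alpha>)) ^ i
      \<le> 2 * t powr (-\<alpha>) * (if i \<le> k then (1/2) ^ (k - i) else (1/2) ^ (i - Suc k))" for i
  proof (cases "i \<le> k")
    case True
    have le: "M ^ i / t \<le> M powr (- real (k - i))"
    proof -
      have "M ^ i / t \<le> M ^ i / M ^ k" using M t k by (intro divide_left_mono mult_pos_pos) auto
      also have "\<dots> = M powr (real i - real k)" using M by (simp add: powr_diff powr_realpow)
      finally show ?thesis using True by (simp add: of_nat_diff)
    qed
    have pos: "0 < M ^ i / t" using M t by simp
    have "min 1 (2 * M ^ i / t) * (M powr (-\<alpha>)) ^ i \<le> 2 * (M ^ i / t) * (M powr (-\<alpha>)) ^ i"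
      by (intro mult_right_mono) auto
    also have "\<dots> = 2 * t powr (-\<alpha>) * (M ^ i / t) powr (1 - \<alpha>)"
    proof -
      have "(M powr (-\<alpha>)) ^ i = (M ^ i) powr (-\<alpha>)"
        using M by (simp add: powr_realpow[symmetric] powr_powr mult.commute)
      also have "\<dots> = t powr (-\<alpha>) * (M ^ i / t) powr (-\<alpha>)"
        using M t by (simp add: powr_divide)
      also have "(M ^ i / t) * \<dots> = t powr (-\<alpha>) * (M ^ i / t) powr (1 - \<alpha>)"
        using pos by (simp add: powr_diff powr_minus divide_inverse)
      finally show ?thesis by simp
    qed
    finally have 1: "min 1 (2 * M ^ i / t) * (M powr (-\<alpha>)) ^ i
      \<le> 2 * t powr (-\<alpha>) * (M ^ i / t) powr (1 - \<alpha>)" .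
    have "(M ^ i / t) powr (1 - \<alpha>) \<le> (1/2) ^ (k - i)"
    proof -
      have "(M ^ i / t) powr (1 - \<alpha>) \<le> (M powr (- real (k - i))) powr (1 - \<alpha>)"
        using le a pos by (intro powr_mono2) auto
      also have "\<dots> \<le> M powr (- \<alpha> * real (k - i))"
      proof -
        have "\<alpha> * real (k - i) \<le> (1 - \<alpha>) * real (k - i)" using a by (intro mult_right_mono) auto
        then show ?thesis using M unfolding powr_powr by (intro powr_mono) (auto simp: algebra_simps)
      qed
      also have "\<dots> = (M powr (-\<alpha>)) ^ (k - i)"
        using M by (simp add: powr_realpow[symmetric] powr_powr)
      also have "\<dots> \<le> (1/2) ^ (k - i)" by (rule half)
      finally show ?thesis .
    qed
    then have "2 * t powr (-\<alpha>) * (M ^ i / t) powr (1 - \<alpha>) \<le> 2 * t powr (-\<alpha>) * (1/2) ^ (k - i)"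
      by (intro mult_left_mono) auto
    with 1 True show ?thesis by simp
  next
    case False
    then have i: "i = Suc k + (i - Suc k)" by simp
    have "min 1 (2 * M ^ i / t) * (M powr (-\<alpha>)) ^ i \<le> 1 * (M powr (-\<alpha>)) ^ i"
      by (intro mult_right_mono) auto
    also have "\<dots> = (M powr (-\<alpha>)) ^ Suc k * (M powr (-\<alpha>)) ^ (i - Suc k)"
      by (subst i, subst power_add) simp
    also have "\<dots> \<le> 2 * t powr (-\<alpha>) * (1/2) ^ (i - Suc k)"
    proof (intro mult_mono half)
      have "(M powr (-\<alpha>)) ^ Suc k = (M ^ Suc k) powr (-\<alpha>)"
        using M by (simp add: powr_realpow[symmetric] powr_powr mult.commute del: power_Suc of_nat_Suc)
      also have "\<dots> \<le> t powr (-\<alpha>)" using k t a by (intro powr_mono2') auto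
      finally show "(M powr (-\<alpha>)) ^ Suc k \<le> 2 * t powr (-\<alpha>)"
        using powr_ge_zero[of t "-\<alpha>"] by linarith
    qed auto
    finally show ?thesis using False by simp
  qed
  then have "(\<Sum>i<N. min 1 (2 * M ^ i / t) * (M powr (-\<alpha>)) ^ i)
      \<le> (\<Sum>i<N. 2 * t powr (-\<alpha>) * (if i \<le> k then (1/2) ^ (k - i) else (1/2) ^ (i - Suc k)))"
    by (intro sum_mono)
  also have "\<dots> \<le> 2 * t powr (-\<alpha>) * 4"
    unfolding sum_distrib_left[symmetric]
    using sum_two_sided_geometric_le[of k N] by (intro mult_left_mono) auto
  finally show ?thesis by simp
qed

context cantor_choice
begin

text \<open>The transforms converge pointwise by geometric comparison, and the stage measures are
  tight because they live on [0,1). Tightness supplies a candidate limit along a subsequence, and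
  Levy's continuity theorem upgrades this to the whole sequence.\<close>

lemma Ex_weak_limit: "\<exists>\<nu>. real_distribution \<nu> \<and> weak_conv_m (stage_measure M A w) \<nu>"
proof -
  let ?s = "stage_measure M A w"
  have "convergent (\<lambda>j. char (?s j) t)" for t
  proof (cases "t = 0")
    case True
    then show ?thesis by (simp add: real_distribution.char_zero[OF real_distribution_stage] convergent_const)
  next
    case False
    have "summable (\<lambda>j. char (?s (Suc j)) t - char (?s j) t)"
    proof (rule summable_comparison_test')
      show "summable (\<lambda>j. 2 * \<bar>t\<bar> * (1 / 2) ^ j)" by (intro summable_mult summable_geometric) auto
      fix j
      have "cmod (char (?s (Suc j)) t - char (?s j) t) \<le> 1 * (2 * \<bar>t\<bar> / real M ^ j)"
        unfolding char_stage_Suc[OF False] add_diff_cancel_left' norm_mult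
        using False M0 by (intro mult_mono cmod_sinc_exp(1) cmod_step_sum_le) auto
      also have "\<dots> = 2 * \<bar>t\<bar> * (1 / real M) ^ j" by (simp add: power_divide)
      also have "\<dots> \<le> 2 * \<bar>t\<bar> * (1 / 2) ^ j"
        using M2 by (intro mult_left_mono power_mono divide_left_mono) auto
      finally show "cmod (char (?s (Suc j)) t - char (?s j) t) \<le> 2 * \<bar>t\<bar> * (1 / 2) ^ j" .
    qed
    then have "convergent (\<lambda>n. \<Sum>j<n. char (?s (Suc j)) t - char (?s j) t)"
      by (simp only: summable_iff_convergent)
    then have "convergent (\<lambda>n. char (?s 0) t + (char (?s n) t - char (?s 0) t))"
      unfolding sum_lessThan_telescope[of "\<lambda>j. char (?s j) t"] by (intro convergent_add convergent_const)
    then show ?thesis by simp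
  qed
  then have lim: "(\<lambda>j. char (?s j) t) \<longlonglongrightarrow> lim (\<lambda>j. char (?s j) t)" for t
    by (simp add: convergent_LIMSEQ_iff)
  have "tight ?s"
    unfolding tight_def
  proof (intro conjI allI impI real_distribution_stage)
    fix \<epsilon> :: real assume "0 < \<epsilon>"
    then have "\<forall>n. 1 - \<epsilon> < measure (?s n) {-1<..1}"
      using emeasure_stage[of "{-1<..1}"] by (simp add: measure_def subset_eq)
    then show "\<exists>a b. a < b \<and> (\<forall>n. 1 - \<epsilon> < measure (?s n) {a<..b})"
      by (intro exI[of _ "-1"] exI[of _ 1]) auto
  qed
  from tight_imp_convergent_subsubsequence[OF this strict_mono_id]
  obtain r \<nu> where r: "strict_mono r" "real_distribution \<nu>" "weak_conv_m (?s \<circ> r) \<nu>"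
    by auto
  \<comment> \<open>The full sequence of transforms is already known to converge, so its limit can
    be computed along the subsequence.\<close>
  have "(\<lambda>j. char (?s j) t) \<longlonglongrightarrow> char \<nu> t" for t
  proof -
    have "(\<lambda>j. char ((?s \<circ> r) j) t) \<longlonglongrightarrow> char \<nu> t"
      using r by (intro levy_continuity1) (simp_all add: real_distribution_stage o_def)
    moreover have "(\<lambda>j. char ((?s \<circ> r) j) t) \<longlonglongrightarrow> lim (\<lambda>j. char (?s j) t)"
      using LIMSEQ_subseq_LIMSEQ[OF lim r(1)] by (simp add: o_def)
    ultimately show ?thesis using lim[of t] LIMSEQ_unique by metis
  qed
  then have "weak_conv_m ?s \<nu>"
    using r by (intro levy_continuity real_distribution_stage)
  with r show ?thesis by auto
qed

text \<open>Levy's uniqueness theorem excludes a second weak limit, so the \<open>THE\<close> in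
  \<open>cantor_measure\<close> is proper.\<close>

lemma
  shows real_distribution_cantor: "real_distribution (cantor_measure M A w)"
    and weak_conv_cantor: "weak_conv_m (stage_measure M A w) (cantor_measure M A w)"
proof -
  obtain \<nu> where \<nu>: "real_distribution \<nu>" "weak_conv_m (stage_measure M A w) \<nu>"
    using Ex_weak_limit by auto
  have "\<nu>' = \<nu>" if "real_distribution \<nu>'" "weak_conv_m (stage_measure M A w) \<nu>'" for \<nu>'
  proof (rule Levy_uniqueness[OF that(1) \<nu>(1)], rule ext)
    fix t
    show "char \<nu>' t = char \<nu> t"
      by (rule LIMSEQ_unique; rule levy_continuity1[OF real_distribution_stage]) (use \<nu> that in auto)
  qed
  with \<nu> have "\<exists>!\<nu>. real_distribution \<nu> \<and> weak_conv_m (stage_measure M A w) \<nu>"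
    by blast
  then have "real_distribution (cantor_measure M A w) \<and> weak_conv_m (stage_measure M A w) (cantor_measure M A w)"
    unfolding cantor_measure_def by (rule theI')
  then show "real_distribution (cantor_measure M A w)"
    "weak_conv_m (stage_measure M A w) (cantor_measure M A w)" by auto
qed

text \<open>Telescoping over the steps from stage 0, the uniform law on [0,1]. That law contributes
  2 and the steps 4 * 8 = 32, whence 34. For |t| < 1 the trivial bound 1 suffices. The stage bounds
  pass to the weak limit.\<close>

lemma char_cantor_le:
  assumes step: "\<And>j t. cmod (step_sum M A w j t) \<le> 4 * (real M powr (-\<alpha>)) ^ Suc j"
    and a: "0 < \<alpha>" "\<alpha> \<le> 1/2" "2 \<le> real M powr \<alpha>" and t: "t \<noteq> 0"
  shows "cmod (char (cantor_measure M A w) t) \<le> 34 * \<bar>t\<bar> powr (-\<alpha>)"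
proof (cases "1 \<le> \<bar>t\<bar>")
  case False
  have "\<bar>t\<bar> powr (-\<alpha>) \<ge> 1"
    using powr_mono2'[of "-\<alpha>" "\<bar>t\<bar>" 1] a t False by simp
  then show ?thesis
    using real_distribution.cmod_char_le_1[OF real_distribution_cantor, of t] by simp
next
  case True
  let ?s = "stage_measure M A w"
  have "cmod (char (?s J) t) \<le> 34 * \<bar>t\<bar> powr (-\<alpha>)" for J
  proof -
    have "char (?s J) t = char (?s 0) t + (\<Sum>j<J. sinc_exp (t / real M ^ Suc j) * step_sum M A w j t)"
      by (induction J) (simp_all add: char_stage_Suc[OF t] del: power_Suc)
    then have "cmod (char (?s J) t)
        \<le> cmod (char (?s 0) t) + (\<Sum>j<J. cmod (sinc_exp (t / real M ^ Suc j) * step_sum M A w j t))"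
      by (simp only:) (rule order_trans[OF norm_triangle_ineq add_left_mono[OF norm_sum]])
    moreover have "cmod (char (?s 0) t) \<le> 2 * \<bar>t\<bar> powr (-\<alpha>)"
    proof -
      have "cmod (char (?s 0) t) \<le> 2 / \<bar>t\<bar>"
        using cmod_sinc_exp(2)[of t] t by (simp add: char_stage)
      also have "\<dots> = 2 * \<bar>t\<bar> powr (-1)"
        using True by (simp add: powr_minus divide_inverse del: abs_ge_self)
      also have "\<dots> \<le> 2 * \<bar>t\<bar> powr (-\<alpha>)"
        using True a by (intro mult_left_mono powr_mono) auto
      finally show ?thesis .
    qed
    moreover have "(\<Sum>j<J. cmod (sinc_exp (t / real M ^ Suc j) * step_sum M A w j t)) \<le> 32 * \<bar>t\<bar> powr (-\<alpha>)"
    proof -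
      have "(\<Sum>j<J. cmod (sinc_exp (t / real M ^ Suc j) * step_sum M A w j t))
          \<le> (\<Sum>j<J. 4 * (min 1 (2 * real M ^ Suc j / \<bar>t\<bar>) * (real M powr (-\<alpha>)) ^ Suc j))"
      proof (rule sum_mono)
        fix j
        have "cmod (sinc_exp (t / real M ^ Suc j)) \<le> min 1 (2 * real M ^ Suc j / \<bar>t\<bar>)"
          using cmod_sinc_exp[of "t / real M ^ Suc j"] t M0 by (simp add: abs_divide del: power_Suc)
        then have "cmod (sinc_exp (t / real M ^ Suc j)) * cmod (step_sum M A w j t)
            \<le> min 1 (2 * real M ^ Suc j / \<bar>t\<bar>) * (4 * (real M powr (-\<alpha>)) ^ Suc j)"
          by (intro mult_mono step) auto
        then show "cmod (sinc_exp (t / real M ^ Suc j) * step_sum M A w j t)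
            \<le> 4 * (min 1 (2 * real M ^ Suc j / \<bar>t\<bar>) * (real M powr (-\<alpha>)) ^ Suc j)"
          unfolding norm_mult by (simp only: mult.left_commute)
      qed
      \<comment> \<open>Step \<open>Suc j\<close> belongs to scale \<open>Suc j\<close>, so the
        index shifts by one; the added term at \<open>i = 0\<close> is nonnegative.\<close>
      also have "\<dots> \<le> 4 * (\<Sum>i<Suc J. min 1 (2 * real M ^ i / \<bar>t\<bar>) * (real M powr (-\<alpha>)) ^ i)"
        unfolding sum_distrib_left[symmetric] sum.lessThan_Suc_shift by simp
      also have "\<dots> \<le> 4 * (8 * \<bar>t\<bar> powr (-\<alpha>))"
        using sum_min_powr_le[of "real M" \<alpha> "\<bar>t\<bar>" "Suc J"] M2 a True by (intro mult_left_mono) auto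
      finally show ?thesis by simp
    qed
    ultimately show ?thesis by linarith
  qed
  moreover have "(\<lambda>J. cmod (char (?s J) t)) \<longlonglongrightarrow> cmod (char (cantor_measure M A w) t)"
    by (intro tendsto_norm levy_continuity1 real_distribution_stage real_distribution_cantor weak_conv_cantor)
  ultimately show ?thesis by (intro LIMSEQ_le_const2) auto
qed

end

section \<open>Energy\<close>

context cantor_choice
begin

lemma cell_ancestor:
  assumes "x \<in> cell J n" "i \<le> J"
  shows "int (n div M ^ (J - i)) = \<lfloor>x * real M ^ i\<rfloor>"
proof -
  have x: "0 \<le> x" "n = nat \<lfloor>x * real M ^ J\<rfloor>" using assms(1) mem_cell_iff by auto
  then have n: "int n = \<lfloor>x * real M ^ J\<rfloor>" by simp
  have "x * real M ^ i = x * real M ^ J / real_of_int (int M ^ (J - i))"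
  proof -
    have "real M ^ J = real M ^ i * real M ^ (J - i)" using assms(2) by (simp add: power_add[symmetric])
    then show ?thesis using M0 by simp
  qed
  also have "\<lfloor>\<dots>\<rfloor> = \<lfloor>x * real M ^ J\<rfloor> div (int M ^ (J - i))"
    by (rule floor_divide_real_eq_div) simp
  finally show ?thesis using n by (simp add: zdiv_int)
qed

text \<open>Truncating the kernel at \<open>h\<close> makes it bounded and continuous, so stage
  bounds pass to the weak limit. Distances above 1/M contribute 2 * 18 = 36 through
  \<open>first\<close>; smaller ones contribute at most 3 * (4/3) = 4 by counting cells.\<close>

lemma energy_le:
  assumes first: "\<And>b. b \<le> M \<Longrightarrow>
      (\<Sum>a\<in>w 1 0. (real M / max 1 \<bar>real a - real b\<bar>) powr \<alpha>) \<le> 18 * real A"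
    and a: "0 < \<alpha>" "\<alpha> \<le> 1" "real M powr (2 * \<alpha>) \<le> real A" "4 * real M powr \<alpha> \<le> real A"
    and h: "0 < h"
  shows "(LINT y|cantor_measure M A w. max h \<bar>x - y\<bar> powr (-\<alpha>)) \<le> 40"
proof -
  \<comment> \<open>Projecting \<open>x\<close> to [0,1] cannot increase its distance to points of
    [0,1], and it puts the first-scale index \<open>b\<close> into the range 0 to \<open>M\<close>
    covered by \<open>first\<close>.\<close>
  define x' where "x' = max 0 (min 1 x)"
  have x': "0 \<le> x'" "x' \<le> 1" by (auto simp: x'_def)
  define b where "b = nat \<lfloor>x' * real M\<rfloor>"
  have "\<lfloor>x' * real M\<rfloor> \<le> \<lfloor>real M\<rfloor>" using x' by (intro floor_mono) (auto intro: mult_left_le_one_le)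
  then have b: "b \<le> M" "int b = \<lfloor>x' * real M\<rfloor>" using x' by (auto simp: b_def)
  obtain I0 where "(1 / real M) ^ I0 < h"
    using real_arch_pow_inv[of h "1 / real M"] h M2 by auto
  \<comment> \<open>Scales beyond \<open>I\<close> are hidden by the truncation at \<open>h\<close>.
    The successor guarantees 1 \<le> I, so at least one scale is available.\<close>
  define I where "I = Suc I0"
  have "(1 / real M) ^ Suc I \<le> (1 / real M) ^ I0"
    using M2 by (intro power_decreasing) (auto simp: I_def)
  with \<open>(1 / real M) ^ I0 < h\<close> have Ih: "(1 / real M) ^ Suc I \<le> h" by simp
  define f where "f c = (real M / max 1 \<bar>real c - real b\<bar>) powr \<alpha>" for c
  \<comment> \<open>Marks the cells at scale \<open>i\<close> that contain \<open>x'\<close> or are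
    adjacent to its cell.\<close>
  define near where "near i c = (if \<bar>\<lfloor>x' * real M ^ i\<rfloor> - int c\<bar> \<le> 1 then 1 else 0 :: real)" for i c
  have pw: "max h \<bar>x - y\<bar> powr (-\<alpha>)
      \<le> 2 * f (n div M ^ (J - 1)) + (\<Sum>i=1..I. real M powr (\<alpha> * real (Suc i)) * near i (n div M ^ (J - i)))"
    if J: "I \<le> J" and n: "n \<in> P J" and y: "y \<in> cell J n" for J n y
  proof -
    have "y \<in> {0..<1}" by (rule subsetD[OF cell_subset[OF n] y])
    then have y01: "0 \<le> y" "y \<le> 1" by auto
    define d where "d = \<bar>x' - y\<bar>"
    have "max h d \<le> max h \<bar>x - y\<bar>" using y01 by (auto simp: d_def x'_def)
    then have "max h \<bar>x - y\<bar> powr (-\<alpha>) \<le> max h d powr (-\<alpha>)"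
      using h a by (intro powr_mono2') auto
    also have "\<dots> \<le> 2 * f (n div M ^ (J - 1)) + (\<Sum>i=1..I. real M powr (\<alpha> * real (Suc i)) * near i (n div M ^ (J - i)))"
    proof (cases "1 / real M \<le> d")
      case True
      define c where "c = n div M ^ (J - 1)"
      have c: "int c = \<lfloor>y * real M\<rfloor>" using cell_ancestor[OF y, of 1] J by (simp add: c_def I_def)
      define m where "m = max 1 \<bar>real c - real b\<bar>"
      have d1: "1 \<le> \<bar>x' * real M - y * real M\<bar>"
      proof -
        have "\<bar>x' * real M - y * real M\<bar> = d * real M" by (simp add: d_def left_diff_distrib[symmetric] abs_mult)
        then show ?thesis using True M0 by (simp add: field_simps)
      qed
      have "\<bar>real c - real b\<bar> \<le> \<bar>x' * real M - y * real M\<bar> + 1"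
      proof -
        have "real c = real_of_int \<lfloor>y * real M\<rfloor>" "real b = real_of_int \<lfloor>x' * real M\<rfloor>"
          using b c by (metis of_int_of_nat_eq)+
        then show ?thesis by linarith
      qed
      \<comment> \<open>Rounding to first-scale indices changes a distance of at least one cell by
        at most a factor 2; this costs 2 powr \<alpha> \<le> 2.\<close>
      then have "m \<le> 2 * \<bar>x' * real M - y * real M\<bar>" using d1 by (simp add: m_def)
      also have "\<dots> = 2 * (d * real M)" by (simp add: d_def left_diff_distrib[symmetric] abs_mult)
      finally have "m / (2 * real M) \<le> d" using M0 by (simp add: field_simps)
      then have m: "m / (2 * real M) \<le> max h d" by linarith
      have m1: "1 \<le> m" by (simp add: m_def)
      have "max h d powr (-\<alpha>) \<le> (m / (2 * real M)) powr (-\<alpha>)"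
        using m m1 M0 a by (intro powr_mono2') auto
      also have "\<dots> = 2 powr \<alpha> * (real M / m) powr \<alpha>"
        using m1 M0 by (simp add: powr_minus powr_divide powr_mult inverse_eq_divide)
      also have "\<dots> \<le> 2 powr 1 * (real M / m) powr \<alpha>"
        using a by (intro mult_right_mono powr_mono) auto
      also have "\<dots> = 2 * f c" by (simp add: f_def m_def)
      also have "\<dots> \<le> 2 * f c + (\<Sum>i=1..I. real M powr (\<alpha> * real (Suc i)) * near i (n div M ^ (J - i)))"
        by (simp add: sum_nonneg near_def)
      finally show ?thesis by (simp add: c_def)
    next
      case False
      \<comment> \<open>The finest available scale at which \<open>x'\<close> and \<open>y\<close>
        are closer than one cell width. The next scale is no longer than \<open>max h d\<close>,
        which bounds the kernel by M^(\<alpha>(i+1)).\<close>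
      define i where "i = (GREATEST i. i \<le> I \<and> d < (1 / real M) ^ i)"
      have 1: "1 \<le> I \<and> d < (1 / real M) ^ 1" using False by (simp add: I_def)
      have i: "i \<le> I \<and> d < (1 / real M) ^ i"
        unfolding i_def by (rule GreatestI_nat[where P = "\<lambda>i. i \<le> I \<and> d < (1 / real M) ^ i", OF 1]) auto
      have i1: "1 \<le> i"
        unfolding i_def by (rule Greatest_le_nat[where P = "\<lambda>i. i \<le> I \<and> d < (1 / real M) ^ i", OF 1]) auto
      have "(1 / real M) ^ Suc i \<le> max h d"
      proof (cases "i = I")
        case True
        then show ?thesis using Ih by simp
      next
        case False
        have "\<not> (Suc i \<le> I \<and> d < (1 / real M) ^ Suc i)"
          using Greatest_le_nat[where P = "\<lambda>i. i \<le> I \<and> d < (1 / real M) ^ i" and b = I and k = "Suc i"]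
          unfolding i_def[symmetric] by auto
        then have "(1 / real M) ^ Suc i \<le> d" using False i by linarith
        then show ?thesis by linarith
      qed
      then have "max h d powr (-\<alpha>) \<le> ((1 / real M) ^ Suc i) powr (-\<alpha>)"
        using M0 a by (intro powr_mono2') auto
      also have "\<dots> = real M powr (\<alpha> * real (Suc i))"
        using M0 by (simp add: power_one_over powr_minus powr_realpow[symmetric] powr_powr inverse_eq_divide
            powr_divide mult.commute del: power_Suc of_nat_Suc)
      also have "\<dots> = real M powr (\<alpha> * real (Suc i)) * near i (n div M ^ (J - i))"
      proof -
        have "\<bar>x' * real M ^ i - y * real M ^ i\<bar> = d * real M ^ i"
          by (simp add: d_def left_diff_distrib[symmetric] abs_mult)
        also have "\<dots> < (1 / real M) ^ i * real M ^ i" using i Mj0[of i] by (intro mult_strict_right_mono) auto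
        also have "\<dots> = 1" using M0 by (simp add: power_one_over)
        finally have "\<bar>\<lfloor>x' * real M ^ i\<rfloor> - \<lfloor>y * real M ^ i\<rfloor>\<bar> \<le> 1" by linarith
        then show ?thesis
          using cell_ancestor[OF y, of i] i J by (simp add: near_def)
      qed
      also have "\<dots> \<le> (\<Sum>i=1..I. real M powr (\<alpha> * real (Suc i)) * near i (n div M ^ (J - i)))"
        using i i1 by (intro member_le_sum) (auto simp: near_def)
      also have "\<dots> \<le> 2 * f (n div M ^ (J - 1)) + \<dots>" by (simp add: f_def)
      finally show ?thesis .
    qed
    finally show ?thesis .
  qed
  have stage: "(LINT y|stage_measure M A w J. max h \<bar>x - y\<bar> powr (-\<alpha>)) \<le> 40" if J: "I \<le> J" for J
  proof -
    have "(LINT y|stage_measure M A w J. max h \<bar>x - y\<bar> powr (-\<alpha>))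
       \<le> (\<Sum>n\<in>P J. 2 * f (n div M ^ (J - 1))
            + (\<Sum>i=1..I. real M powr (\<alpha> * real (Suc i)) * near i (n div M ^ (J - i)))) / real A ^ J"
    proof (rule integral_stage_le[where B = "h powr (-\<alpha>)"])
      show "\<bar>max h \<bar>x - y\<bar> powr (-\<alpha>)\<bar> \<le> h powr (-\<alpha>)" for y
        using h a by (simp add: powr_mono2')
    qed (use pw[OF J] in auto)
    also have "\<dots> = 2 * (\<Sum>n\<in>P J. f (n div M ^ (J - 1))) / real A ^ J
        + (\<Sum>i=1..I. real M powr (\<alpha> * real (Suc i)) * ((\<Sum>n\<in>P J. near i (n div M ^ (J - i))) / real A ^ J))"
    proof -
      have "(\<Sum>n\<in>P J. \<Sum>i=1..I. real M powr (\<alpha> * real (Suc i)) * near i (n div M ^ (J - i)))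
        = (\<Sum>i=1..I. real M powr (\<alpha> * real (Suc i)) * (\<Sum>n\<in>P J. near i (n div M ^ (J - i))))"
        by (subst sum.swap) (simp add: sum_distrib_left)
      then show ?thesis
        by (simp add: sum.distrib add_divide_distrib sum_distrib_left[symmetric] sum_divide_distrib[symmetric])
    qed
    also have "\<dots> \<le> 36 + (\<Sum>i=1..I. 3 * (1/4) ^ (i - 1))"
    proof (rule add_mono)
      have "(\<Sum>n\<in>P J. f (n div M ^ (J - 1))) = real (A ^ (J - 1)) * (\<Sum>m\<in>P 1. f m)"
        using J by (intro sum_ancestors) (simp add: I_def)
      moreover have "P 1 = w 1 0" by simp
      moreover have "(\<Sum>m\<in>w 1 0. f m) \<le> 18 * real A" unfolding f_def by (rule first[OF b(1)])
      moreover have "real A ^ J = real A ^ (J - 1) * real A"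
        using J by (simp add: I_def power_eq_if)
      ultimately show "2 * (\<Sum>n\<in>P J. f (n div M ^ (J - 1))) / real A ^ J \<le> 36"
        using A0 by (simp add: field_simps)
    next
      show "(\<Sum>i=1..I. real M powr (\<alpha> * real (Suc i)) * ((\<Sum>n\<in>P J. near i (n div M ^ (J - i))) / real A ^ J))
        \<le> (\<Sum>i=1..I. 3 * (1/4) ^ (i - 1))"
      proof (rule sum_mono)
        fix i assume i: "i \<in> {1..I}"
        have "(\<Sum>n\<in>P J. near i (n div M ^ (J - i))) = real (A ^ (J - i)) * (\<Sum>m\<in>P i. near i m)"
          using i J by (intro sum_ancestors) auto
        moreover have "(\<Sum>m\<in>P i. near i m) \<le> 3"
        proof -
          have "(\<Sum>m\<in>P i. near i m) = real (card {m\<in>P i. \<bar>\<lfloor>x' * real M ^ i\<rfloor> - int m\<bar> \<le> 1})"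
            unfolding near_def using finite_nums[of i] by (simp add: sum.If_cases Int_def)
          \<comment> \<open>At most three integers lie within distance 1 of the floor.\<close>
          also have "card {m\<in>P i. \<bar>\<lfloor>x' * real M ^ i\<rfloor> - int m\<bar> \<le> 1}
              \<le> card {\<lfloor>x' * real M ^ i\<rfloor> - 1..\<lfloor>x' * real M ^ i\<rfloor> + 1}"
            by (rule card_inj_on_le[where f = int]) auto
          finally show ?thesis by simp
        qed
        moreover have "real A ^ J = real A ^ (J - i) * real A ^ i"
          using i J by (simp add: power_add[symmetric])
        ultimately have 1: "(\<Sum>n\<in>P J. near i (n div M ^ (J - i))) / real A ^ J \<le> 3 / real A ^ i"
          using A0 by (simp add: field_simps)
        have "real M powr (\<alpha> * real (Suc i)) = real M powr (2 * \<alpha>) * (real M powr \<alpha>) ^ (i - 1)"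
          using i M0 by (simp add: powr_realpow[symmetric] powr_powr powr_add[symmetric] of_nat_diff algebra_simps)
        moreover have "real A ^ i = real A * real A ^ (i - 1)" using i by (simp add: power_eq_if)
        ultimately have "real M powr (\<alpha> * real (Suc i)) * (3 / real A ^ i)
            = 3 * (real M powr (2 * \<alpha>) / real A) * (real M powr \<alpha> / real A) ^ (i - 1)"
          by (simp add: power_divide)
        \<comment> \<open>The two size conditions on \<open>A\<close> enter here: M^(2\<alpha>)
          \<le> A absorbs the first scale and 4 M^\<alpha> \<le> A makes the later scales
          geometric.\<close>
        also have "\<dots> \<le> 3 * 1 * (1/4) ^ (i - 1)"
          using a A0 by (intro mult_mono power_mono) (auto simp: field_simps)
        finally show "real M powr (\<alpha> * real (Suc i)) * ((\<Sum>n\<in>P J. near i (n div M ^ (J - i))) / real A ^ J)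
            \<le> 3 * (1/4) ^ (i - 1)"
          using mult_left_mono[OF 1, of "real M powr (\<alpha> * real (Suc i))"] by simp
      qed
    qed
    also have "(\<Sum>i=1..I. 3 * (1/4) ^ (i - 1)) = 3 * (\<Sum>i<I. (1/4) ^ i :: real)"
      unfolding sum_distrib_left by (rule sum.reindex_bij_witness[of _ Suc "\<lambda>i. i - 1"]) auto
    also have "36 + \<dots> \<le> 40"
      using sum_le_suminf[of "\<lambda>i. (1/4::real) ^ i" "{..<I}"] by (simp add: suminf_geometric)
    finally show ?thesis .
  qed
  have "(\<lambda>J. LINT y|stage_measure M A w J. max h \<bar>x - y\<bar> powr (-\<alpha>))
      \<longlonglongrightarrow> (LINT y|cantor_measure M A w. max h \<bar>x - y\<bar> powr (-\<alpha>))"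
  proof (rule weak_conv_imp_integral_bdd_continuous_conv[where B = "h powr (-\<alpha>)"])
    show "isCont (\<lambda>y. max h \<bar>x - y\<bar> powr (-\<alpha>)) y" for y
      using h by (intro continuous_intros) auto
    show "norm (max h \<bar>x - y\<bar> powr (-\<alpha>)) \<le> h powr (-\<alpha>)" for y
      using h a by (simp add: powr_mono2')
  qed (rule real_distribution_stage real_distribution_cantor weak_conv_cantor)+
  then show ?thesis using stage by (intro LIMSEQ_le_const2) auto
qed

end

section \<open>Schur's test\<close>

context real_distribution
begin

lemma char_uminus: "char M (- t) = cnj (char M t)"
proof -
  have "cnj (char M t) = (CLINT x|M. cnj (iexp (t * x)))"
    unfolding char_def by (rule Bochner_Integration.integral_cnj[symmetric])
  also have "\<dots> = char M (- t)"
    unfolding char_def by (intro Bochner_Integration.integral_cong) (simp_all add: exp_cnj)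
  finally show ?thesis by simp
qed

lemma L2_fun_imp_integrable:
  assumes "u \<in> L2_fun M"
  shows "integrable M u"
proof (rule Bochner_Integration.integrable_bound)
  show "integrable M (\<lambda>x. (cmod (u x))\<^sup>2 + 1)"
    using assms by (auto simp: L2_fun_def)
  show "u \<in> borel_measurable M" using assms by (auto simp: L2_fun_def)
  show "AE x in M. norm (u x) \<le> norm ((cmod (u x))\<^sup>2 + 1)"
  proof (rule AE_I2)
    fix x
    have "0 \<le> (cmod (u x) - 1)\<^sup>2" by simp
    then have "2 * cmod (u x) \<le> (cmod (u x))\<^sup>2 + 1" by (simp add: power2_diff)
    then have "cmod (u x) \<le> (cmod (u x))\<^sup>2 + 1" using norm_ge_zero[of "u x"] by linarith
    then show "norm (u x) \<le> norm ((cmod (u x))\<^sup>2 + 1)" by simp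
  qed
qed

lemma borel_measurable_fourier_op:
  assumes "u \<in> L2_fun M"
  shows "fourier_op M h u \<in> borel_measurable M"
proof -
  have [measurable]: "u \<in> borel_measurable borel" using assms by (simp add: L2_fun_def cong: measurable_cong_sets)
  show ?thesis
    unfolding fourier_op_def by measurable
qed

lemma cmod_fourier_op_le:
  assumes "u \<in> L2_fun M"
  shows "cmod (fourier_op M h u \<xi>) \<le> (LINT x|M. cmod (u x))"
  unfolding fourier_op_def
  by (rule order_trans[OF integral_norm_bound]) (simp add: norm_mult)

text \<open>The image is bounded by the L^1 norm of \<open>u\<close> on a probability space.
  Membership gives content to bounds on \<open>L2_nrm\<close>, since the integral of a
  non-integrable function is 0 by default.\<close>

lemma fourier_op_in_L2:
  assumes "u \<in> L2_fun M"
  shows "fourier_op M h u \<in> L2_fun M"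
proof -
  note borel_measurable_fourier_op[OF assms, measurable]
  have "integrable M (\<lambda>\<xi>. (cmod (fourier_op M h u \<xi>))\<^sup>2)"
  proof (rule integrable_const_bound)
    show "AE \<xi> in M. norm ((cmod (fourier_op M h u \<xi>))\<^sup>2) \<le> (LINT x|M. cmod (u x))\<^sup>2"
      using cmod_fourier_op_le[OF assms] by (auto intro!: AE_I2 power_mono)
  qed measurable
  then show ?thesis by (simp add: L2_fun_def)
qed

text \<open>Here \<open>M\<close> is the measure. Expanding |Tu|^2 and integrating out \<xi> gives
  the quadratic form of \<open>u\<close> with kernel \<open>K\<close>, the transform at (y - x) / h.
  Since |K| is symmetric, 2 |u(x) u(y)| \<le> |u(x)|^2 + |u(y)|^2 bounds the form by the row
  integrals.\<close>

lemma L2_nrm_fourier_op_le: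
  assumes u: "u \<in> L2_fun M"
    and S: "\<And>x. (LINT y|M. cmod (char M ((x - y) / h))) \<le> S"
  shows "(L2_nrm M (fourier_op M h u))\<^sup>2 \<le> S * (L2_nrm M u)\<^sup>2"
proof -
  interpret MM: pair_sigma_finite M M ..
  interpret P: pair_prob_space M M ..
  interpret M3: pair_sigma_finite M "M \<Otimes>\<^sub>M M" ..
  have [measurable]: "u \<in> borel_measurable borel" using u by (simp add: L2_fun_def cong: measurable_cong_sets)
  have [measurable]: "cnj \<in> borel_measurable borel"
    by (intro borel_measurable_continuous_onI continuous_intros)
  note borel_measurable_fourier_op[OF u, measurable]
  have u1: "integrable M u" by (rule L2_fun_imp_integrable[OF u])
  have u2: "integrable M (\<lambda>x. (cmod (u x))\<^sup>2)" using u by (simp add: L2_fun_def)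
  let ?T = "fourier_op M h u"
  define e where "e \<xi> x = exp (- (\<i> * of_real x * of_real \<xi> / of_real h))" for \<xi> x :: real
  have e_norm [simp]: "cmod (e \<xi> x) = 1" for \<xi> x by (simp add: e_def)
  have [measurable]: "(\<lambda>p. e (fst p) (fst (snd p))) \<in> borel_measurable (borel \<Otimes>\<^sub>M borel \<Otimes>\<^sub>M borel)"
      "(\<lambda>p. e (fst p) (snd (snd p))) \<in> borel_measurable (borel \<Otimes>\<^sub>M borel \<Otimes>\<^sub>M borel)"
      "e \<xi> \<in> borel_measurable borel" for \<xi>
    unfolding e_def by measurable
  have int_prod: "integrable (M \<Otimes>\<^sub>M M) (\<lambda>p. v (fst p) * v' (snd p))" 
    if [measurable]: "integrable M v" "integrable M v'" for v v' :: "real \<Rightarrow> complex"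
    by (rule MM.Fubini_integrable) (use that in \<open>auto simp: norm_mult\<close>)
  define g where "g p = u (fst p) * cnj (u (snd p))" for p
  have gm [measurable]: "g \<in> borel_measurable (borel \<Otimes>\<^sub>M borel)" unfolding g_def by measurable
  have gi: "integrable (M \<Otimes>\<^sub>M M) g"
    unfolding g_def using u1 by (intro int_prod) auto
  have ei: "integrable M (\<lambda>x. e \<xi> x * u x)" for \<xi>
    by (rule Bochner_Integration.integrable_bound[OF u1]) (auto simp: norm_mult)
  have T2: "of_real ((cmod (?T \<xi>))\<^sup>2) = (LINT p|(M \<Otimes>\<^sub>M M). e \<xi> (fst p) * cnj (e \<xi> (snd p)) * g p)" for \<xi>
  proof -
    have "integrable (M \<Otimes>\<^sub>M M) (\<lambda>p. (e \<xi> (fst p) * u (fst p)) * cnj (e \<xi> (snd p) * u (snd p)))"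
      using ei by (intro int_prod) (auto simp del: complex_cnj_mult)
    from MM.integral_fst'[OF this]
    have "(LINT p|(M \<Otimes>\<^sub>M M). (e \<xi> (fst p) * u (fst p)) * cnj (e \<xi> (snd p) * u (snd p)))
        = (LINT x|M. LINT y|M. (e \<xi> x * u x) * cnj (e \<xi> y * u y))" by simp
    also have "\<dots> = ?T \<xi> * cnj (?T \<xi>)"
      unfolding fourier_op_def e_def[symmetric] Bochner_Integration.integral_cnj[symmetric]
      by (simp del: Bochner_Integration.integral_cnj)
    also have "\<dots> = of_real ((cmod (?T \<xi>))\<^sup>2)" by (simp only: complex_norm_square)
    finally show ?thesis by (simp add: g_def mult_ac)
  qed
  define F where "F q = e (fst q) (fst (snd q)) * cnj (e (fst q) (snd (snd q))) * g (snd q)" for q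
  \<comment> \<open>The phases have modulus one, so integrability of \<open>g\<close> on the product
    carries over to \<open>F\<close> and Fubini applies.\<close>
  have Fi: "integrable (M \<Otimes>\<^sub>M (M \<Otimes>\<^sub>M M)) F"
  proof (rule M3.Fubini_integrable)
    show "F \<in> borel_measurable (M \<Otimes>\<^sub>M (M \<Otimes>\<^sub>M M))" unfolding F_def by measurable
    show "integrable M (\<lambda>x. LINT y|(M \<Otimes>\<^sub>M M). norm (F (x, y)))"
      by (simp add: F_def norm_mult)
    show "AE x in M. integrable (M \<Otimes>\<^sub>M M) (\<lambda>y. F (x, y))"
    proof (rule AE_I2)
      fix x
      show "integrable (M \<Otimes>\<^sub>M M) (\<lambda>y. F (x, y))"
        unfolding F_def by (rule Bochner_Integration.integrable_bound[OF gi]) (auto simp: norm_mult)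
    qed
  qed
  define K where "K p = char M ((snd p - fst p) / h)" for p
  have [measurable]: "K \<in> borel_measurable (borel \<Otimes>\<^sub>M borel)" unfolding K_def by measurable
  have K1: "cmod (K p) \<le> 1" for p unfolding K_def by (rule cmod_char_le_1)
  have inner: "(LINT \<xi>|M. F (\<xi>, p)) = K p * g p" for p
  proof -
    have "e \<xi> (fst p) * cnj (e \<xi> (snd p)) = iexp ((snd p - fst p) / h * \<xi>)" for \<xi>
      unfolding e_def exp_cnj by (simp add: exp_add[symmetric] diff_divide_distrib algebra_simps)
    then show ?thesis by (simp add: F_def K_def char_def)
  qed
  have "of_real (LINT \<xi>|M. (cmod (?T \<xi>))\<^sup>2) = (LINT \<xi>|M. of_real ((cmod (?T \<xi>))\<^sup>2) :: complex)"
    by (rule integral_complex_of_real[symmetric])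
  also have "\<dots> = (LINT \<xi>|M. LINT p|(M \<Otimes>\<^sub>M M). F (\<xi>, p))" unfolding T2 by (simp add: F_def)
  also have "\<dots> = (LINT p|(M \<Otimes>\<^sub>M M). LINT \<xi>|M. F (\<xi>, p))"
    using M3.Fubini_integral[of "\<lambda>x y. F (x, y)"] Fi by simp
  also have "\<dots> = (LINT p|(M \<Otimes>\<^sub>M M). K p * g p)" unfolding inner ..
  finally have eq: "of_real (LINT \<xi>|M. (cmod (?T \<xi>))\<^sup>2) = (LINT p|(M \<Otimes>\<^sub>M M). K p * g p)" .
  have ui: "integrable (M \<Otimes>\<^sub>M M) (\<lambda>p. cmod (K p) * (cmod (u (fst p)))\<^sup>2)"
       "integrable (M \<Otimes>\<^sub>M M) (\<lambda>p. cmod (K p) * (cmod (u (snd p)))\<^sup>2)"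
  proof -
    have "integrable (M \<Otimes>\<^sub>M M) (\<lambda>p. (cmod (u (fst p)))\<^sup>2)" "integrable (M \<Otimes>\<^sub>M M) (\<lambda>p. (cmod (u (snd p)))\<^sup>2)"
      using u2 by (auto intro!: MM.Fubini_integrable simp: prob_space[simplified])
    moreover have "integrable (M \<Otimes>\<^sub>M M) (\<lambda>p. cmod (K p) * v p)"
      if v: "integrable (M \<Otimes>\<^sub>M M) v" for v :: "real \<times> real \<Rightarrow> real"
    proof (rule Bochner_Integration.integrable_bound[OF v])
      show "AE p in M \<Otimes>\<^sub>M M. norm (cmod (K p) * v p) \<le> norm (v p)"
        using K1 by (auto simp: abs_mult mult_left_le_one_le)
    qed (use v in measurable)
    ultimately show "integrable (M \<Otimes>\<^sub>M M) (\<lambda>p. cmod (K p) * (cmod (u (fst p)))\<^sup>2)"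
       "integrable (M \<Otimes>\<^sub>M M) (\<lambda>p. cmod (K p) * (cmod (u (snd p)))\<^sup>2)"
      by blast+
  qed
  have Kint: "integrable M (\<lambda>y. cmod (char M ((x - y) / h)))" for x
    by (rule integrable_const_bound[of _ 1]) (auto simp: cmod_char_le_1)
  have L2: "(LINT x|M. (cmod (u x))\<^sup>2 * (LINT y|M. cmod (char M ((x - y) / h)))) \<le> S * (LINT x|M. (cmod (u x))\<^sup>2)"
  proof -
    have "(LINT x|M. (cmod (u x))\<^sup>2 * (LINT y|M. cmod (char M ((x - y) / h)))) \<le> (LINT x|M. (cmod (u x))\<^sup>2 * S)"
    proof (rule integral_mono')
      show "integrable M (\<lambda>x. (cmod (u x))\<^sup>2 * S)" using u2 by simp
      have "0 \<le> S" by (rule order_trans[OF Bochner_Integration.integral_nonneg S[of 0]]) simp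
      then show "0 \<le> (cmod (u x))\<^sup>2 * S" for x by simp
    qed (use S in \<open>auto intro: mult_left_mono\<close>)
    then show ?thesis by (simp add: mult.commute)
  qed
  have sym: "cmod (char M ((y - x) / h)) = cmod (char M ((x - y) / h))" for x y
    using char_uminus[of "(x - y) / h"] by (simp add: minus_divide_left)
  have "(LINT \<xi>|M. (cmod (?T \<xi>))\<^sup>2) \<le> cmod (of_real (LINT \<xi>|M. (cmod (?T \<xi>))\<^sup>2))" by simp
  also have "\<dots> \<le> (LINT p|(M \<Otimes>\<^sub>M M). cmod (K p * g p))"
    unfolding eq by (rule integral_norm_bound)
  also have "\<dots> \<le> (LINT p|(M \<Otimes>\<^sub>M M). (cmod (K p) * (cmod (u (fst p)))\<^sup>2 + cmod (K p) * (cmod (u (snd p)))\<^sup>2) / 2)"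
  proof (rule integral_mono')
    show "integrable (M \<Otimes>\<^sub>M M) (\<lambda>p. (cmod (K p) * (cmod (u (fst p)))\<^sup>2 + cmod (K p) * (cmod (u (snd p)))\<^sup>2) / 2)"
      using ui by simp
    fix p
    have "0 \<le> (cmod (u (fst p)) - cmod (u (snd p)))\<^sup>2" by simp
    then have "cmod (u (fst p)) * cmod (u (snd p)) \<le> ((cmod (u (fst p)))\<^sup>2 + (cmod (u (snd p)))\<^sup>2) / 2"
      by (simp add: power2_diff)
    from mult_left_mono[OF this, of "cmod (K p)"]
    show "cmod (K p * g p) \<le> (cmod (K p) * (cmod (u (fst p)))\<^sup>2 + cmod (K p) * (cmod (u (snd p)))\<^sup>2) / 2"
      by (simp add: g_def norm_mult distrib_left)
  qed simp
  also have "\<dots> = ((LINT p|(M \<Otimes>\<^sub>M M). cmod (K p) * (cmod (u (fst p)))\<^sup>2)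
      + (LINT p|(M \<Otimes>\<^sub>M M). cmod (K p) * (cmod (u (snd p)))\<^sup>2)) / 2"
    using ui by simp
  also have "(LINT p|(M \<Otimes>\<^sub>M M). cmod (K p) * (cmod (u (fst p)))\<^sup>2)
      = (LINT x|M. (cmod (u x))\<^sup>2 * (LINT y|M. cmod (char M ((x - y) / h))))"
    using MM.integral_fst'[OF ui(1)] by (simp add: K_def sym mult.commute)
  \<comment> \<open>The second half agrees with the first after exchanging the two
    variables.\<close>
  also have "(LINT p|(M \<Otimes>\<^sub>M M). cmod (K p) * (cmod (u (snd p)))\<^sup>2)
      = (LINT x|M. (cmod (u x))\<^sup>2 * (LINT y|M. cmod (char M ((x - y) / h))))"
    using MM.integral_snd[of "\<lambda>x y. cmod (K (x, y)) * (cmod (u y))\<^sup>2"] ui(2)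
    by (simp add: K_def mult.commute case_prod_unfold)
  finally have "(LINT \<xi>|M. (cmod (?T \<xi>))\<^sup>2) \<le> S * (LINT x|M. (cmod (u x))\<^sup>2)"
    using L2 by simp
  then show ?thesis by (simp add: L2_nrm_def)
qed

end

section \<open>Tail bounds on the infinite product space\<close>

text \<open>Resampling coordinate \<open>i\<close> independently preserves the product measure.
  Fubini then averages the section probabilities over the remaining coordinates; this plays the role
  of conditioning.\<close>

lemma emeasure_PiM_le_componentwise:
  assumes M: "\<And>i. i \<in> I \<Longrightarrow> prob_space (M i)" and i: "i \<in> I" and E: "E \<in> sets (PiM I M)"
    and p: "\<And>w. w \<in> space (PiM I M) \<Longrightarrow> emeasure (M i) {y \<in> space (M i). w(i := y) \<in> E} \<le> p"
  shows "emeasure (PiM I M) E \<le> p"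
proof -
  interpret Mi: prob_space "M i" using M i by auto
  interpret P: prob_space "PiM I M" using M by (intro prob_space_PiM) auto
  interpret pair_sigma_finite "M i" "PiM I M" ..
  let ?f = "\<lambda>(x, X). X(i := x)"
  have ins: "insert i I = I" using i by auto
  have [measurable]: "?f \<in> measurable (M i \<Otimes>\<^sub>M PiM I M) (PiM I M)"
    using measurable_fun_upd[of I I i "snd" "M i \<Otimes>\<^sub>M PiM I M" M fst] ins by (simp add: case_prod_unfold)
  have "emeasure (PiM I M) E = emeasure (distr (M i \<Otimes>\<^sub>M PiM I M) (PiM I M) ?f) E"
    using distr_pair_PiM_eq_PiM[of I M i] M i ins by simp
  also have "\<dots> = emeasure (M i \<Otimes>\<^sub>M PiM I M) (?f -` E \<inter> space (M i \<Otimes>\<^sub>M PiM I M))"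
    using E by (intro emeasure_distr) auto
  also have "\<dots> = (\<integral>\<^sup>+w. emeasure (M i) ((\<lambda>x. (x, w)) -` (?f -` E \<inter> space (M i \<Otimes>\<^sub>M PiM I M))) \<partial>PiM I M)"
    using E by (intro emeasure_pair_measure_alt2) auto
  also have "\<dots> \<le> (\<integral>\<^sup>+w. p \<partial>PiM I M)"
  proof (rule nn_integral_mono)
    fix w assume w: "w \<in> space (PiM I M)"
    then have "(\<lambda>x. (x, w)) -` (?f -` E \<inter> space (M i \<Otimes>\<^sub>M PiM I M)) = {y \<in> space (M i). w(i := y) \<in> E}"
      by (auto simp: space_pair_measure)
    then show "emeasure (M i) ((\<lambda>x. (x, w)) -` (?f -` E \<inter> space (M i \<Otimes>\<^sub>M PiM I M))) \<le> p"
      using p[OF w] by simp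
  qed
  also have "\<dots> = p" by (simp add: P.emeasure_space_1)
  finally show ?thesis .
qed

lemma space_mu_step: "space (mu_step M A j) = (\<Pi>\<^sub>E k\<in>{..<A ^ (j - 1)}. alphabets M A)"
  by (simp add: mu_step_def space_uniform_count_measure)

lemma sets_mu_step: "sets (mu_step M A j) = Pow (space (mu_step M A j))"
  by (simp add: mu_step_def space_uniform_count_measure sets_uniform_count_measure)

lemma finite_space_mu_step: "finite (space (mu_step M A j))"
  unfolding space_mu_step by (intro finite_PiE) auto

locale cantor_parameters =
  fixes M A :: nat
  assumes M2: "2 \<le> M" and A0: "0 < A" and AM: "A \<le> M"
begin

lemma alphabets_nonempty: "alphabets M A \<noteq> {}"
  using AM by (auto simp: alphabets_def intro!: exI[of _ "{0..<A}"])

lemma space_mu_step_nonempty: "space (mu_step M A j) \<noteq> {}"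
  unfolding space_mu_step PiE_eq_empty_iff using alphabets_nonempty by auto

lemma prob_space_mu_step: "prob_space (mu_step M A j)"
  using finite_space_mu_step[of M A j] space_mu_step_nonempty[of j]
  unfolding mu_step_def by (intro prob_space_uniform_count_measure) (auto simp: mu_step_def space_uniform_count_measure)

lemma prob_space_mu_inf: "prob_space (mu_inf M A)"
  unfolding mu_inf_def by (intro prob_space_PiM prob_space_mu_step)

lemma mem_space_mu_inf: "w \<in> space (mu_inf M A) \<Longrightarrow> 1 \<le> j \<Longrightarrow> w j \<in> space (mu_step M A j)"
  by (auto simp: mu_inf_def space_PiM)

lemma cantor_choice_mu_inf:
  assumes "w \<in> space (mu_inf M A)"
  shows "cantor_choice M A w"
  by unfold_locales
    (use M2 A0 mem_space_mu_inf[OF assms, of "Suc _"] in \<open>auto simp: space_mu_step\<close>)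

text \<open>The first \<open>n\<close> steps have finitely many outcomes, so such an event is a
  finite union of measurable cylinders. No structure of \<open>Q\<close> is needed, which covers
  quantifiers over all real \<open>t\<close>.\<close>

lemma sets_mu_inf_finite_dependence:
  assumes Q: "\<And>w w'. w \<in> space (mu_inf M A) \<Longrightarrow> w' \<in> space (mu_inf M A) \<Longrightarrow>
      (\<And>j. j \<in> {1..n} \<Longrightarrow> w j = w' j) \<Longrightarrow> Q w = Q w'"
  shows "{w \<in> space (mu_inf M A). Q w} \<in> sets (mu_inf M A)"
proof -
  let ?V = "(\<lambda>w. restrict w {1..n}) ` {w \<in> space (mu_inf M A). Q w}"
  let ?C = "\<lambda>v. {w \<in> space (mu_inf M A). \<forall>j\<in>{1..n}. w j = v j}"
  have "?V \<subseteq> (\<Pi>\<^sub>E j\<in>{1..n}. space (mu_step M A j))"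
    using mem_space_mu_inf by auto
  then have fin: "finite ?V"
    by (rule finite_subset) (intro finite_PiE finite_space_mu_step finite_atLeastAtMost)
  have "{w \<in> space (mu_inf M A). Q w} = (\<Union>v\<in>?V. ?C v)"
  proof (intro equalityI subsetI)
    fix w assume "w \<in> (\<Union>v\<in>?V. ?C v)"
    then obtain w' where w': "w' \<in> space (mu_inf M A)" "Q w'" "w \<in> space (mu_inf M A)"
        "\<forall>j\<in>{1..n}. w j = w' j" by auto
    then show "w \<in> {w \<in> space (mu_inf M A). Q w}" using Q[of w w'] by auto
  qed auto
  also have "\<dots> \<in> sets (mu_inf M A)"
  proof (intro sets.finite_UN fin)
    fix v assume "v \<in> ?V"
    then have v: "v j \<in> space (mu_step M A j)" if "j \<in> {1..n}" for j
      using that mem_space_mu_inf by auto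
    show "?C v \<in> sets (mu_inf M A)"
    proof (rule sets.sets_Collect_finite_All)
      fix j assume j: "j \<in> {1..n}"
      have "(\<lambda>w. w j) -` {v j} \<inter> space (mu_inf M A) \<in> sets (mu_inf M A)"
        unfolding mu_inf_def
        by (rule measurable_sets[OF measurable_component_singleton]) (use j v in \<open>auto simp: sets_mu_step\<close>)
      then show "{w \<in> space (mu_inf M A). w j = v j} \<in> sets (mu_inf M A)"
        by (simp add: vimage_def Int_def conj_commute)
    qed auto
  qed
  finally show ?thesis .
qed

text \<open>Turns a counting estimate for step \<open>j\<close>, uniform in all other steps, into a
  probability estimate.\<close>

lemma measure_mu_inf_le:
  assumes E: "{w \<in> space (mu_inf M A). Q w} \<in> sets (mu_inf M A)" and j: "1 \<le> j" and p: "0 \<le> p"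
    and le: "\<And>w. w \<in> space (mu_inf M A) \<Longrightarrow>
      real (card {y \<in> space (mu_step M A j). Q (w(j := y))}) \<le> p * real (card (space (mu_step M A j)))"
  shows "measure (mu_inf M A) {w \<in> space (mu_inf M A). Q w} \<le> p"
proof -
  let ?E = "{w \<in> space (mu_inf M A). Q w}" and ?\<Omega> = "space (mu_step M A j)"
  interpret P: prob_space "mu_inf M A" by (rule prob_space_mu_inf)
  interpret S: prob_space "mu_step M A j" by (rule prob_space_mu_step)
  have "emeasure (mu_inf M A) ?E \<le> ennreal p"
    unfolding mu_inf_def
  proof (rule emeasure_PiM_le_componentwise)
    show "j \<in> {1..}" using j by simp
    show "{w \<in> space (Pi\<^sub>M {1..} (mu_step M A)). Q w} \<in> sets (Pi\<^sub>M {1..} (mu_step M A))"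
      using E by (simp add: mu_inf_def)
    fix w assume w: "w \<in> space (Pi\<^sub>M {1..} (mu_step M A))"
    let ?Y = "{y \<in> ?\<Omega>. Q (w(j := y))}"
    have "{y \<in> ?\<Omega>. w(j := y) \<in> {w \<in> space (Pi\<^sub>M {1..} (mu_step M A)). Q w}} = ?Y"
      using w j by (auto simp: space_PiM PiE_def extensional_def)
    moreover have "emeasure (mu_step M A j) ?Y = ennreal (real (card ?Y) / real (card ?\<Omega>))"
    proof -
      have "S.prob ?Y = real (card ?Y) / real (card ?\<Omega>)"
        using measure_uniform_count_measure[of ?\<Omega> ?Y] finite_space_mu_step[of M A j]
        by (simp add: mu_step_def space_uniform_count_measure)
      then show ?thesis by (simp add: S.emeasure_eq_measure)
    qed
    moreover have "real (card ?Y) / real (card ?\<Omega>) \<le> p"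
    proof -
      have "0 < card ?\<Omega>" using space_mu_step_nonempty finite_space_mu_step by (simp add: card_gt_0_iff)
      then show ?thesis using le[of w] w by (simp add: mu_inf_def field_simps)
    qed
    ultimately show "emeasure (mu_step M A j) {y \<in> ?\<Omega>. w(j := y) \<in> {w \<in> space (Pi\<^sub>M {1..} (mu_step M A)). Q w}} \<le> ennreal p"
      by (simp add: ennreal_leI)
  qed (rule prob_space_mu_step)
  then show ?thesis using p by (simp add: P.emeasure_eq_measure)
qed

lemma step_sum_cong:
  assumes "\<And>i. 1 \<le> i \<Longrightarrow> i \<le> Suc j \<Longrightarrow> w i = w' i"
  shows "step_sum M A w j t = step_sum M A w' j t"
  using assms cantor_nums_cong[of j w w' M] by (simp add: step_sum_def)

text \<open>The points of stage \<open>j\<close> do not depend on step \<open>Suc j\<close>. With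
  everything else frozen, the real part is a sum over independent alphabets of centred functions,
  and \<open>chernoff_alphabets\<close> applies with N = A^(j+1).\<close>

lemma Re_step_sum_tail:
  assumes c: "cmod c = 1" and \<tau>: "0 < \<tau>"
  shows "measure (mu_inf M A) {w \<in> space (mu_inf M A). \<tau> \<le> Re (c * step_sum M A w j t)}
    \<le> exp (- (real A ^ Suc j * \<tau>\<^sup>2 / 2))"
proof (rule measure_mu_inf_le[where j = "Suc j"])
  show "{w \<in> space (mu_inf M A). \<tau> \<le> Re (c * step_sum M A w j t)} \<in> sets (mu_inf M A)"
  proof (rule sets_mu_inf_finite_dependence[where n = "Suc j"])
    fix w w' :: "nat \<Rightarrow> nat \<Rightarrow> nat set"
    assume "\<And>i. i \<in> {1..Suc j} \<Longrightarrow> w i = w' i"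
    then have "step_sum M A w j t = step_sum M A w' j t" by (intro step_sum_cong) auto
    then show "(\<tau> \<le> Re (c * step_sum M A w j t)) = (\<tau> \<le> Re (c * step_sum M A w' j t))" by simp
  qed
  fix w assume w: "w \<in> space (mu_inf M A)"
  interpret cantor_choice M A w by (rule cantor_choice_mu_inf[OF w])
  let ?r = "\<lambda>n. card {m \<in> P j. m < n}"
  have bij: "bij_betw ?r (P j) {..<A ^ j}"
    using bij_betw_rank[OF finite_nums[of j]] by (simp add: card_nums)
  \<comment> \<open>Inverse of the rank: \<open>q k\<close> is the point served by alphabet number
    \<open>k\<close>.\<close>
  define q where "q = inv_into (P j) ?r"
  have q: "q (?r n) = n" if "n \<in> P j" for n
    unfolding q_def using bij that by (intro inv_into_f_f) (auto simp: bij_betw_def)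
  let ?F = "\<lambda>a. iexp (t * real a / real M ^ Suc j)"
  define m where "m = (\<Sum>a<M. ?F a) / of_nat M"
  define e where "e k = c * iexp (t * real (q k) / real M ^ j)" for k
  define g where "g k a = Re (e k * (?F a - m))" for k a
  have Re: "real A ^ Suc j * Re (c * step_sum M A (w(Suc j := y)) j t) = (\<Sum>k<A ^ j. \<Sum>a\<in>y k. g k a)"
    if y: "y \<in> (\<Pi>\<^sub>E k\<in>{..<A ^ j}. alphabets M A)" for y
  proof -
    have P: "cantor_nums M (w(Suc j := y)) j = P j" by (rule cantor_nums_cong) auto
    have "of_nat A ^ Suc j * step_sum M A (w(Suc j := y)) j t
        = (\<Sum>n\<in>P j. iexp (t * real n / real M ^ j) * ((\<Sum>a\<in>y (?r n). ?F a) - of_nat A / of_nat M * (\<Sum>a<M. ?F a)))"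
      unfolding step_sum_def P using A0 by (simp only: fun_upd_same) simp
    also have "\<dots> = (\<Sum>n\<in>P j. iexp (t * real (q (?r n)) / real M ^ j)
        * ((\<Sum>a\<in>y (?r n). ?F a) - of_nat A / of_nat M * (\<Sum>a<M. ?F a)))"
      by (intro sum.cong refl) (simp only: q)
    also have "\<dots> = (\<Sum>k<A ^ j. iexp (t * real (q k) / real M ^ j)
        * ((\<Sum>a\<in>y k. ?F a) - of_nat A / of_nat M * (\<Sum>a<M. ?F a)))"
      by (rule sum.reindex_bij_betw[OF bij])
    also have "\<dots> = (\<Sum>k<A ^ j. \<Sum>a\<in>y k. iexp (t * real (q k) / real M ^ j) * (?F a - m))"
    proof (rule sum.cong[OF refl])
      fix k assume "k \<in> {..<A ^ j}"
      then have "card (y k) = A" using y by (auto simp: alphabets_def PiE_def Pi_def)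
      then show "iexp (t * real (q k) / real M ^ j) * ((\<Sum>a\<in>y k. ?F a) - of_nat A / of_nat M * (\<Sum>a<M. ?F a))
          = (\<Sum>a\<in>y k. iexp (t * real (q k) / real M ^ j) * (?F a - m))"
        by (simp add: sum_distrib_left[symmetric] sum_subtractf m_def)
    qed
    finally have "c * (of_nat A ^ Suc j * step_sum M A (w(Suc j := y)) j t) = (\<Sum>k<A ^ j. \<Sum>a\<in>y k. e k * (?F a - m))"
      by (simp add: sum_distrib_left e_def mult.assoc)
    then have "Re (c * (of_nat A ^ Suc j * step_sum M A (w(Suc j := y)) j t)) = (\<Sum>k<A ^ j. \<Sum>a\<in>y k. g k a)"
      by (simp only: Re_sum g_def)
    moreover have "c * (of_nat A ^ Suc j * step_sum M A (w(Suc j := y)) j t)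
        = of_real (real A ^ Suc j) * (c * step_sum M A (w(Suc j := y)) j t)"
      by simp
    moreover have "Re (of_real r * z) = r * Re z" for r z by simp
    ultimately show ?thesis by (simp only:)
  qed
  have "real (card {y \<in> (\<Pi>\<^sub>E k\<in>{..<A ^ j}. alphabets M A). real (card {..<A ^ j} * A) * \<tau> \<le> (\<Sum>k\<in>{..<A ^ j}. \<Sum>a\<in>y k. g k a)})
      \<le> exp (- (real (card {..<A ^ j} * A) * \<tau>\<^sup>2 / 2)) * real (card (\<Pi>\<^sub>E k\<in>{..<A ^ j}. alphabets M A))"
  \<comment> \<open>Before centring, each term is the real part of a unimodular number, so it lies
    in [-1,1]; centring shifts this interval of length 2.\<close>
  proof (rule chernoff_alphabets[where l = "\<lambda>k. - 1 - Re (e k * m)"])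
    show "(\<Sum>a<M. g k a) = 0" for k
    proof -
      have "(\<Sum>a<M. g k a) = Re (e k * (\<Sum>a<M. ?F a - m))"
        by (simp only: g_def Re_sum[symmetric] sum_distrib_left[symmetric])
      also have "(\<Sum>a<M. ?F a - m) = 0" using M0 by (simp add: sum_subtractf m_def)
      finally show ?thesis by simp
    qed
    show "- 1 - Re (e k * m) \<le> g k a \<and> g k a \<le> - 1 - Re (e k * m) + 2" for k a
    proof -
      have "\<bar>Re (e k * ?F a)\<bar> \<le> cmod (e k * ?F a)" by (rule abs_Re_le_cmod)
      also have "\<dots> = 1" using c by (simp add: e_def norm_mult del: power_Suc)
      finally have "\<bar>Re (e k * ?F a)\<bar> \<le> 1" .
      moreover have "g k a = Re (e k * ?F a) - Re (e k * m)" by (simp only: g_def right_diff_distrib minus_complex.sel)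
      ultimately show ?thesis by linarith
    qed
  qed (use M0 \<tau> in auto)
  moreover have "{y \<in> space (mu_step M A (Suc j)). \<tau> \<le> Re (c * step_sum M A (w(Suc j := y)) j t)}
      = {y \<in> (\<Pi>\<^sub>E k\<in>{..<A ^ j}. alphabets M A). real (card {..<A ^ j} * A) * \<tau> \<le> (\<Sum>k\<in>{..<A ^ j}. \<Sum>a\<in>y k. g k a)}"
  proof -
    have "\<tau> \<le> Re (c * step_sum M A (w(Suc j := y)) j t)
        \<longleftrightarrow> real (card {..<A ^ j} * A) * \<tau> \<le> (\<Sum>k\<in>{..<A ^ j}. \<Sum>a\<in>y k. g k a)"
      if "y \<in> (\<Pi>\<^sub>E k\<in>{..<A ^ j}. alphabets M A)" for y
      unfolding Re[OF that, symmetric] using A0 by simp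
    then show ?thesis unfolding space_mu_step by auto
  qed
  ultimately show "real (card {y \<in> space (mu_step M A (Suc j)). \<tau> \<le> Re (c * step_sum M A (w(Suc j := y)) j t)})
      \<le> exp (- (real A ^ Suc j * \<tau>\<^sup>2 / 2)) * real (card (space (mu_step M A (Suc j))))"
    by (simp add: space_mu_step mult.commute)
qed auto

end

section \<open>Reduction to finitely many frequencies\<close>

context cantor_choice
begin

text \<open>All points n M + a are at most M^(j+1), so each exponential is 1-Lipschitz in
  \<open>t\<close>; the sum and its centring each have total weight 1.\<close>

lemma step_sum_lipschitz: "cmod (step_sum M A w j t - step_sum M A w j t') \<le> 2 * \<bar>t - t'\<bar>"
proof -
  let ?e = "\<lambda>t k. iexp (t * real k / real M ^ Suc j)"
  have e: "cmod (?e t (n * M + a) - ?e t' (n * M + a)) \<le> \<bar>t - t'\<bar>" if "n \<in> P j" "a < M" for n a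
  proof -
    let ?k = "n * M + a"
    have "Suc n * M \<le> M ^ j * M" using nums_less[OF that(1)] by (intro mult_le_mono) auto
    then have "?k \<le> M ^ Suc j" using that(2) by (simp add: mult.commute)
    then have k: "real ?k \<le> real M ^ Suc j" by (metis of_nat_le_iff of_nat_power)
    have "t * real ?k / real M ^ Suc j = t' * real ?k / real M ^ Suc j + (t - t') * real ?k / real M ^ Suc j"
      by (simp add: algebra_simps diff_divide_distrib del: power_Suc)
    then have "?e t ?k = ?e t' ?k * iexp ((t - t') * real ?k / real M ^ Suc j)"
      by (simp only: iexp_add)
    then have "?e t ?k - ?e t' ?k = ?e t' ?k * (iexp ((t - t') * real ?k / real M ^ Suc j) - 1)"
      by (simp only: right_diff_distrib mult_1_right)
    then have "cmod (?e t ?k - ?e t' ?k) = cmod (iexp ((t - t') * real ?k / real M ^ Suc j) - 1)"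
      by (simp only: norm_mult norm_exp_i_times mult_1)
    also have "\<dots> \<le> \<bar>(t - t') * real ?k / real M ^ Suc j\<bar>" by (rule cmod_iexp_diff_1)
    also have "\<dots> = \<bar>t - t'\<bar> * (real ?k / real M ^ Suc j)" by (simp add: abs_mult)
    also have "\<dots> \<le> \<bar>t - t'\<bar> * 1"
      using k Mj0[of "Suc j"] by (intro mult_left_mono) (auto simp del: power_Suc)
    finally show ?thesis by simp
  qed
  define B where "B t n = (\<Sum>a\<in>alph j n. ?e t (n * M + a)) - of_nat A / of_nat M * (\<Sum>a<M. ?e t (n * M + a))" for t n
  have B: "cmod (B t n - B t' n) \<le> 2 * real A * \<bar>t - t'\<bar>" if n: "n \<in> P j" for n
  proof -
    have al: "alph j n \<subseteq> {..<M}" "card (alph j n) = A" using alph[OF n] by (auto simp: alphabets_def)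
    let ?d = "\<lambda>a. ?e t (n * M + a) - ?e t' (n * M + a)"
    have eq: "B t n - B t' n = (\<Sum>a\<in>alph j n. ?d a) - of_nat A / of_nat M * (\<Sum>a<M. ?d a)"
      unfolding B_def sum_subtractf right_diff_distrib by (simp only: diff_diff_eq2 diff_add_eq add_diff_eq diff_diff_eq) (simp only: add.commute)
    have "cmod (\<Sum>a\<in>alph j n. ?d a) \<le> (\<Sum>a\<in>alph j n. \<bar>t - t'\<bar>)"
    proof (rule order_trans[OF norm_sum sum_mono])
      fix a assume "a \<in> alph j n"
      then show "cmod (?d a) \<le> \<bar>t - t'\<bar>" using al(1) by (intro e n) auto
    qed
    then have 1: "cmod (\<Sum>a\<in>alph j n. ?d a) \<le> real A * \<bar>t - t'\<bar>" by (simp only: sum_constant al)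
    have "cmod (\<Sum>a<M. ?d a) \<le> (\<Sum>a<M. \<bar>t - t'\<bar>)"
      by (rule order_trans[OF norm_sum sum_mono]) (blast intro: e n)
    then have "cmod (\<Sum>a<M. ?d a) \<le> real M * \<bar>t - t'\<bar>" by (simp only: sum_constant card_lessThan)
    then have "cmod (of_nat A / of_nat M * (\<Sum>a<M. ?d a)) \<le> real A / real M * (real M * \<bar>t - t'\<bar>)"
      unfolding norm_mult norm_divide norm_of_nat by (intro mult_left_mono) auto
    with 1 have "cmod (B t n - B t' n) \<le> real A * \<bar>t - t'\<bar> + real A / real M * (real M * \<bar>t - t'\<bar>)"
      unfolding eq by (intro order_trans[OF norm_triangle_ineq4] add_mono)
    also have "\<dots> = 2 * real A * \<bar>t - t'\<bar>" using M0 by simp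
    finally show ?thesis .
  qed
  have "step_sum M A w j t - step_sum M A w j t' = (\<Sum>n\<in>P j. B t n - B t' n) / of_nat A ^ Suc j"
    unfolding step_sum_eq B_def[symmetric] by (simp only: sum_subtractf diff_divide_distrib)
  then have "cmod (step_sum M A w j t - step_sum M A w j t') = cmod (\<Sum>n\<in>P j. B t n - B t' n) / real A ^ Suc j"
    by (simp only: norm_divide norm_power norm_of_nat)
  also have "\<dots> \<le> (\<Sum>n\<in>P j. 2 * real A * \<bar>t - t'\<bar>) / real A ^ Suc j"
    by (intro divide_right_mono order_trans[OF norm_sum sum_mono] B) auto
  also have "\<dots> = 2 * \<bar>t - t'\<bar>" using A0 by (simp add: card_nums)
  finally show ?thesis .
qed

text \<open>By \<open>step_sum_eq\<close> only integer multiples of 1 / M^(j+1) occur as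
  frequencies.\<close>

lemma step_sum_periodic:
  "step_sum M A w j (t + 2 * pi * real M ^ Suc j * of_int z) = step_sum M A w j t"
proof -
  have "iexp ((t + 2 * pi * real M ^ Suc j * of_int z) * real k / real M ^ Suc j)
      = iexp (t * real k / real M ^ Suc j)" for k
  proof -
    have "(t + 2 * pi * real M ^ Suc j * of_int z) * real k / real M ^ Suc j
        = t * real k / real M ^ Suc j + 2 * pi * of_int (z * int k)"
      using M0 by (simp add: field_simps)
    moreover have "iexp (2 * pi * of_int (z * int k)) = 1"
      using exp_integer_2pi[of "of_int (z * int k)"] by (simp add: mult_ac)
    ultimately show ?thesis by (simp only: iexp_add mult_1_right)
  qed
  then show ?thesis by (simp only: step_sum_eq)
qed

text \<open>With L = M^(j+1), the grid of mesh 1/L covers one period 2 pi L, and 2 pi \<le> 7 bounds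
  its indices by 7 L^2. The four directions control |Re| and |Im|, giving 2 \<tau>; the Lipschitz
  constant 2 gives the error 2/L.\<close>

lemma cmod_step_sum_le_grid:
  assumes "\<And>m c. m \<le> 7 * M ^ (2 * Suc j) \<Longrightarrow> c \<in> {1, -1, \<i>, -\<i>} \<Longrightarrow>
      Re (c * step_sum M A w j (real m / real M ^ Suc j)) \<le> \<tau>"
  shows "cmod (step_sum M A w j t) \<le> 2 * \<tau> + 2 / real M ^ Suc j"
proof -
  let ?L = "real M ^ Suc j"
  have L: "0 < ?L" using M0 by simp
  define z where "z = \<lfloor>t / (2 * pi * ?L)\<rfloor>"
  define t' where "t' = t - 2 * pi * ?L * of_int z"
  have pL: "0 < 2 * pi * ?L" using L pi_gt_zero by simp
  have "of_int z \<le> t / (2 * pi * ?L)" "t / (2 * pi * ?L) \<le> of_int z + 1" unfolding z_def by linarith+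
  then have t': "0 \<le> t'" "t' \<le> 2 * pi * ?L"
    using pL by (simp_all add: t'_def pos_le_divide_eq pos_divide_le_eq algebra_simps del: power_Suc)
  define m where "m = nat \<lfloor>t' * ?L\<rfloor>"
  have m: "real m \<le> t' * ?L" "t' * ?L \<le> real m + 1"
    using t' L unfolding m_def by (simp_all add: of_nat_nat del: power_Suc)
  have "real m \<le> 2 * pi * ?L * ?L" using m(1) t' L by (meson mult_right_mono less_imp_le order_trans)
  also have "\<dots> \<le> 7 * (?L * ?L)"
  proof -
    have "pi \<le> 7 / 2" using pi_less_4 pi_approx by simp
    then have "2 * pi * (?L * ?L) \<le> 7 * (?L * ?L)" by (intro mult_right_mono) auto
    then show ?thesis by (simp only: mult.assoc)
  qed
  also have "\<dots> = real (7 * M ^ (2 * Suc j))" 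
    by (simp only: mult_2[of "Suc j"] power_add of_nat_mult of_nat_power of_nat_numeral)
  finally have m7: "m \<le> 7 * M ^ (2 * Suc j)" by (simp only: of_nat_le_iff)
  let ?z = "step_sum M A w j (real m / ?L)"
  have "\<bar>Re ?z\<bar> \<le> \<tau>" "\<bar>Im ?z\<bar> \<le> \<tau>"
    using assms[OF m7, of 1] assms[OF m7, of "-1"] assms[OF m7, of \<i>] assms[OF m7, of "-\<i>"]
    by (simp_all del: power_Suc add: abs_le_iff)
  then have "cmod ?z \<le> 2 * \<tau>" using cmod_le[of ?z] by linarith
  moreover have "cmod (step_sum M A w j t' - ?z) \<le> 2 / ?L"
  proof -
    have "real m / ?L \<le> t'" "t' \<le> (real m + 1) / ?L"
      using m L by (simp_all add: pos_le_divide_eq pos_divide_le_eq del: power_Suc)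
    then have "\<bar>t' - real m / ?L\<bar> \<le> 1 / ?L"
      unfolding add_divide_distrib by linarith
    then show ?thesis using step_sum_lipschitz[of j t' "real m / ?L"] by simp
  qed
  moreover have "cmod (step_sum M A w j t) = cmod (step_sum M A w j t')"
    using step_sum_periodic[of j t' z] by (simp only: t'_def diff_add_cancel)
  moreover have "cmod (step_sum M A w j t') \<le> cmod ?z + cmod (step_sum M A w j t' - ?z)"
    by (rule norm_triangle_sub)
  ultimately show ?thesis by linarith
qed

end

context cantor_parameters
begin

lemma sets_step_sum_bounded:
  "{w \<in> space (mu_inf M A). \<exists>t. s < cmod (step_sum M A w j t)} \<in> sets (mu_inf M A)"
proof (rule sets_mu_inf_finite_dependence[where n = "Suc j"])
  fix w w' :: "nat \<Rightarrow> nat \<Rightarrow> nat set"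
  assume "\<And>i. i \<in> {1..Suc j} \<Longrightarrow> w i = w' i"
  then have "step_sum M A w j t = step_sum M A w' j t" for t by (intro step_sum_cong) auto
  then show "(\<exists>t. s < cmod (step_sum M A w j t)) = (\<exists>t. s < cmod (step_sum M A w' j t))" by simp
qed

text \<open>Union bound over grid points and four directions, using 4 (7 L^2 + 1) \<le> 32 L^2 for L
  = M^(j+1). The assumption on \<tau> absorbs the Lipschitz error, turning 2 \<tau> + 2/L into at
  most 4 \<tau>.\<close>

lemma measure_step_sum_bounded:
  assumes \<tau>: "1 / real M ^ Suc j \<le> \<tau>"
  shows "measure (mu_inf M A) {w \<in> space (mu_inf M A). \<exists>t. 4 * \<tau> < cmod (step_sum M A w j t)}
    \<le> 32 * real M ^ (2 * Suc j) * exp (- (real A ^ Suc j * \<tau>\<^sup>2 / 2))"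
proof -
  interpret prob_space "mu_inf M A" by (rule prob_space_mu_inf)
  let ?p = "exp (- (real A ^ Suc j * \<tau>\<^sup>2 / 2))"
  have \<tau>0: "0 < \<tau>" by (rule less_le_trans[OF _ \<tau>]) (use M2 in simp)
  define K where "K = {..7 * M ^ (2 * Suc j)} \<times> {1, -1, \<i>, -\<i>}"
  define E where "E = (\<lambda>(m, c). {w \<in> space (mu_inf M A). \<tau> \<le> Re (c * step_sum M A w j (real m / real M ^ Suc j))})"
  have fin: "finite K" by (simp add: K_def)
  have E_sets: "E p \<in> sets (mu_inf M A)" for p
    unfolding E_def case_prod_unfold
  proof (rule sets_mu_inf_finite_dependence[where n = "Suc j"])
    fix w w' :: "nat \<Rightarrow> nat \<Rightarrow> nat set"
    assume "\<And>i. i \<in> {1..Suc j} \<Longrightarrow> w i = w' i"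
    then have "step_sum M A w j t = step_sum M A w' j t" for t by (intro step_sum_cong) auto
    then show "(\<tau> \<le> Re (snd p * step_sum M A w j (real (fst p) / real M ^ Suc j)))
      = (\<tau> \<le> Re (snd p * step_sum M A w' j (real (fst p) / real M ^ Suc j)))" by simp
  qed
  have "{w \<in> space (mu_inf M A). \<exists>t. 4 * \<tau> < cmod (step_sum M A w j t)} \<subseteq> (\<Union>p\<in>K. E p)"
  proof (rule subsetI, rule ccontr)
    fix w assume w: "w \<in> {w \<in> space (mu_inf M A). \<exists>t. 4 * \<tau> < cmod (step_sum M A w j t)}"
      and "w \<notin> (\<Union>p\<in>K. E p)"
    then have small: "Re (c * step_sum M A w j (real m / real M ^ Suc j)) \<le> \<tau>"
      if "m \<le> 7 * M ^ (2 * Suc j)" "c \<in> {1, -1, \<i>, -\<i>}" for m c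
      using that unfolding K_def E_def by fastforce
    interpret cantor_choice M A w using w by (intro cantor_choice_mu_inf) auto
    obtain t where "4 * \<tau> < cmod (step_sum M A w j t)" using w by auto
    moreover have "cmod (step_sum M A w j t) \<le> 2 * \<tau> + 2 / real M ^ Suc j"
      by (rule cmod_step_sum_le_grid[OF small])
    ultimately show False using \<tau> by simp
  qed
  then have "prob {w \<in> space (mu_inf M A). \<exists>t. 4 * \<tau> < cmod (step_sum M A w j t)} \<le> prob (\<Union>p\<in>K. E p)"
    using E_sets fin by (intro finite_measure_mono) auto
  also have "\<dots> \<le> (\<Sum>p\<in>K. prob (E p))"
    using E_sets fin by (intro finite_measure_subadditive_finite) auto
  also have "\<dots> \<le> (\<Sum>p\<in>K. ?p)"
  proof (rule sum_mono)
    fix p assume "p \<in> K"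
    then have "cmod (snd p) = 1" by (auto simp: K_def)
    then show "prob (E p) \<le> ?p"
      unfolding E_def case_prod_unfold by (intro Re_step_sum_tail \<tau>0)
  qed
  also have "\<dots> = real (card K) * ?p" by simp
  also have "\<dots> \<le> 32 * real M ^ (2 * Suc j) * ?p"
  proof (rule mult_right_mono)
    have "card {1, -1, \<i>, -\<i>} \<le> 4" by (intro card_insert_le_m1) auto
    then have "card K \<le> (7 * M ^ (2 * Suc j) + 1) * 4"
      unfolding K_def card_cartesian_product by (intro mult_le_mono) auto
    also have "\<dots> \<le> 32 * M ^ (2 * Suc j)" using M2 by simp
    finally have "real (card K) \<le> real (32 * M ^ (2 * Suc j))" by (simp only: of_nat_le_iff)
    then show "real (card K) \<le> 32 * real M ^ (2 * Suc j)" by simp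
  qed simp
  finally show ?thesis .
qed

end

section \<open>The distance kernel over the first alphabet\<close>

lemma sum_inverse_sqrt_le: "(\<Sum>k\<in>{1..n}. 1 / sqrt (real k)) \<le> 2 * sqrt (real n)"
proof (induction n)
  case (Suc n)
  have "1 / sqrt (real (Suc n)) \<le> 2 * (sqrt (real (Suc n)) - sqrt (real n))"
  proof -
    let ?a = "sqrt (real (Suc n))" and ?b = "sqrt (real n)"
    have a: "0 < ?a" and b: "?b \<le> ?a" by auto
    have "1 = (?a - ?b) * (?a + ?b)" by (simp add: algebra_simps flip: power2_eq_square)
    also have "\<dots> \<le> (?a - ?b) * (2 * ?a)" using b by (intro mult_left_mono) auto
    finally show ?thesis using a by (simp add: field_simps)
  qed
  with Suc show ?case by simp
qed auto

text \<open>Each distance from \<open>b\<close> occurs at most twice, once on either side.\<close>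

lemma sum_dist_le:
  assumes G: "\<And>k. 0 \<le> G k" and b: "b \<le> M"
  shows "(\<Sum>a<M. G (nat \<bar>int a - int b\<bar>)) \<le> 2 * (\<Sum>k\<le>M. G k :: real)"
proof -
  have "(\<Sum>a<M. G (nat \<bar>int a - int b\<bar>)) = (\<Sum>a\<in>{a. a < M \<and> a \<le> b}. G (nat \<bar>int a - int b\<bar>)) + (\<Sum>a\<in>{a. a < M \<and> b < a}. G (nat \<bar>int a - int b\<bar>))"
    by (subst sum.union_disjoint[symmetric]) (auto intro!: sum.cong)
  also have "(\<Sum>a\<in>{a. a < M \<and> a \<le> b}. G (nat \<bar>int a - int b\<bar>)) = (\<Sum>k\<in>(\<lambda>a. b - a) ` {a. a < M \<and> a \<le> b}. G k)"
    by (subst sum.reindex) (auto intro!: inj_onI sum.cong arg_cong[of _ _ G])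
  also have "(\<Sum>a\<in>{a. a < M \<and> b < a}. G (nat \<bar>int a - int b\<bar>)) = (\<Sum>k\<in>(\<lambda>a. a - b) ` {a. a < M \<and> b < a}. G k)"
    by (subst sum.reindex) (auto intro!: inj_onI sum.cong arg_cong[of _ _ G])
  finally show ?thesis
    using sum_mono2[of "{..M}" "(\<lambda>a. b - a) ` {a. a < M \<and> a \<le> b}" G]
      sum_mono2[of "{..M}" "(\<lambda>a. a - b) ` {a. a < M \<and> b < a}" G] G b
    by fastforce
qed

text \<open>The base is at least 1 and \<alpha> \<le> 1/2, so the kernel is at most its square-root
  version. The factor 6 is 2 for the two sides times 3 from 1 + 2 sqrt M \<le> 3 sqrt M.\<close>

lemma sum_dist_powr_le:
  assumes "0 < M" "b \<le> M" "0 < \<alpha>" "\<alpha> \<le> 1/2"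
  shows "(\<Sum>a<M. (real M / max 1 \<bar>real a - real b\<bar>) powr \<alpha>) \<le> 6 * real M"
proof -
  let ?G = "\<lambda>k::nat. sqrt (real M) / sqrt (max 1 (real k))"
  have "(real M / max 1 \<bar>real a - real b\<bar>) powr \<alpha> \<le> ?G (nat \<bar>int a - int b\<bar>)" if "a < M" for a
  proof -
    have "max 1 \<bar>real a - real b\<bar> \<le> real M" using assms that by (auto simp: max_def abs_if)
    then have "1 \<le> real M / max 1 \<bar>real a - real b\<bar>" by (simp add: field_simps)
    then have "(real M / max 1 \<bar>real a - real b\<bar>) powr \<alpha> \<le> (real M / max 1 \<bar>real a - real b\<bar>) powr (1/2)"
      using assms by (intro powr_mono) auto
    also have "\<dots> = sqrt (real M / max 1 \<bar>real a - real b\<bar>)" by (intro powr_half_sqrt) simp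
    finally show ?thesis by (simp add: real_sqrt_divide)
  qed
  then have "(\<Sum>a<M. (real M / max 1 \<bar>real a - real b\<bar>) powr \<alpha>) \<le> (\<Sum>a<M. ?G (nat \<bar>int a - int b\<bar>))"
    by (intro sum_mono) auto
  also have "\<dots> \<le> 2 * (\<Sum>k\<le>M. ?G k)" using assms by (intro sum_dist_le) auto
  also have "(\<Sum>k\<le>M. ?G k) = sqrt (real M) * (1 + (\<Sum>k\<in>{1..M}. 1 / sqrt (real k)))"
  proof -
    have "{..M} = insert 0 {1..M}" by auto
    then have "(\<Sum>k\<le>M. ?G k) = ?G 0 + (\<Sum>k\<in>{1..M}. ?G k)" by simp
    also have "(\<Sum>k\<in>{1..M}. ?G k) = (\<Sum>k\<in>{1..M}. sqrt (real M) * (1 / sqrt (real k)))"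
      by (intro sum.cong refl) (auto simp: max_def)
    finally show ?thesis by (simp add: distrib_left sum_distrib_left)
  qed
  also have "2 * \<dots> \<le> 2 * (sqrt (real M) * (3 * sqrt (real M)))"
  proof (intro mult_left_mono)
    have "1 \<le> sqrt (real M)" using assms by simp
    then show "1 + (\<Sum>k\<in>{1..M}. 1 / sqrt (real k)) \<le> 3 * sqrt (real M)"
      using sum_inverse_sqrt_le[of M] by linarith
  qed auto
  also have "\<dots> = 6 * real M" by simp
  finally show ?thesis .
qed

text \<open>Chernoff bound at parameter 1/B with threshold three times the mean bound. Since exp v
  \<le> 1 + 2 v on [0,1], one draw has exponential moment at most exp (12/B); the exponent is 12 -
  18 = -6 in units of A/B.\<close>

lemma upper_tail_alphabets:
  fixes f :: "nat \<Rightarrow> real"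
  assumes M: "0 < M" and f: "\<And>a. a < M \<Longrightarrow> 0 \<le> f a \<and> f a \<le> B" and B: "0 < B"
    and mean: "(\<Sum>a<M. f a) \<le> 6 * real M"
  shows "real (card {S \<in> alphabets M A. 18 * real A < (\<Sum>a\<in>S. f a)})
    \<le> exp (- (6 * real A / B)) * real (card (alphabets M A))"
proof -
  let ?E = "{S \<in> alphabets M A. 18 * real A < (\<Sum>a\<in>S. f a)}"
  have "real (card ?E) * exp (18 * real A / B) = (\<Sum>S\<in>?E. exp (18 * real A / B))" by simp
  also have "\<dots> \<le> (\<Sum>S\<in>?E. exp (\<Sum>a\<in>S. f a / B))"
    using B by (intro sum_mono) (auto simp: sum_divide_distrib[symmetric] divide_right_mono)
  also have "\<dots> \<le> (\<Sum>S\<in>alphabets M A. exp (\<Sum>a\<in>S. f a / B))"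
    by (intro sum_mono2) auto
  also have "\<dots> \<le> real (card (alphabets M A)) * ((\<Sum>a<M. exp (f a / B)) / real M) ^ A"
    by (rule sum_alphabets_exp_le)
  also have "\<dots> \<le> real (card (alphabets M A)) * exp (12 / B) ^ A"
  proof (intro mult_left_mono power_mono)
    have "(\<Sum>a<M. exp (f a / B)) \<le> (\<Sum>a<M. 1 + 2 * (f a / B))"
    proof (rule sum_mono)
      fix a assume "a \<in> {..<M}"
      then have 1: "0 \<le> f a / B" "f a / B \<le> 1" using f[of a] B by auto
      then have "exp (f a / B) \<le> 1 + f a / B + (f a / B)\<^sup>2" by (rule exp_bound)
      also have "(f a / B)\<^sup>2 \<le> f a / B" unfolding power2_eq_square using 1 by (intro mult_left_le) auto
      finally show "exp (f a / B) \<le> 1 + 2 * (f a / B)" by simp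
    qed
    also have "\<dots> = real M + 2 * (\<Sum>a<M. f a) / B"
      by (simp add: sum.distrib sum_distrib_left sum_divide_distrib)
    also have "\<dots> \<le> real M + 2 * (6 * real M) / B"
      using mean B by (intro add_left_mono divide_right_mono) auto
    also have "\<dots> = real M * (1 + 12 / B)" by (simp add: distrib_left)
    also have "\<dots> \<le> real M * exp (12 / B)" by (intro mult_left_mono exp_ge_add_one_self) auto
    finally show "(\<Sum>a<M. exp (f a / B)) / real M \<le> exp (12 / B)"
      using M by (simp add: field_simps)
  qed (auto intro!: divide_nonneg_nonneg sum_nonneg)
  also have "exp (12 / B) ^ A = exp (12 * real A / B)" by (simp add: exp_of_nat_mult[symmetric] mult.commute)
  finally have "real (card ?E) \<le> real (card (alphabets M A)) * exp (12 * real A / B) / exp (18 * real A / B)"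
    by (simp add: field_simps)
  also have "\<dots> = real (card (alphabets M A)) * exp (- (6 * real A / B))"
  proof -
    have "- (6 * real A / B) = 12 * real A / B - 18 * real A / B"
      by (simp add: diff_divide_distrib[symmetric])
    then show ?thesis by (simp only: exp_diff times_divide_eq_right)
  qed
  finally show ?thesis by (simp add: mult.commute)
qed

context cantor_parameters
begin

lemma sets_first_alphabet: "{w \<in> space (mu_inf M A). Q (w 1 0)} \<in> sets (mu_inf M A)"
  by (rule sets_mu_inf_finite_dependence[where n = 1]) auto

lemma measure_first_alphabet:
  assumes b: "b \<le> M" and a: "0 < \<alpha>" "\<alpha> \<le> 1/2"
  shows "measure (mu_inf M A) {w \<in> space (mu_inf M A).
      18 * real A < (\<Sum>a\<in>w 1 0. (real M / max 1 \<bar>real a - real b\<bar>) powr \<alpha>)}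
    \<le> exp (- (6 * real A / real M powr \<alpha>))"
proof (rule measure_mu_inf_le[where j = 1])
  let ?f = "\<lambda>a. (real M / max 1 \<bar>real a - real b\<bar>) powr \<alpha>"
  let ?Q = "\<lambda>S. 18 * real A < (\<Sum>a\<in>S. ?f a)"
  show "{w \<in> space (mu_inf M A). ?Q (w 1 0)} \<in> sets (mu_inf M A)" by (rule sets_first_alphabet)
  fix w
  have "{y \<in> space (mu_step M A 1). ?Q ((w(1 := y)) 1 0)} = (\<Pi>\<^sub>E k\<in>{..<1}. {S \<in> alphabets M A. ?Q S})"
    by (auto simp: space_mu_step PiE_def Pi_def)
  then have "card {y \<in> space (mu_step M A 1). ?Q ((w(1 := y)) 1 0)} = card {S \<in> alphabets M A. ?Q S}"
    by (simp add: card_PiE)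
  moreover have "card (space (mu_step M A 1)) = card (alphabets M A)"
    by (simp add: space_mu_step card_PiE)
  moreover have "real (card {S \<in> alphabets M A. ?Q S}) \<le> exp (- (6 * real A / real M powr \<alpha>)) * real (card (alphabets M A))"
  proof (rule upper_tail_alphabets)
    show "(\<Sum>a<M. ?f a) \<le> 6 * real M" using M2 b a by (intro sum_dist_powr_le) auto
    show "0 \<le> ?f c \<and> ?f c \<le> real M powr \<alpha>" for c
    proof -
      have "real M / max 1 \<bar>real c - real b\<bar> \<le> real M / 1" by (intro divide_left_mono) auto
      then show ?thesis using a by (auto intro!: powr_mono2)
    qed
  qed (use M2 in auto)
  ultimately show "real (card {y \<in> space (mu_step M A 1). ?Q ((w(1 := y)) 1 0)})
      \<le> exp (- (6 * real A / real M powr \<alpha>)) * real (card (space (mu_step M A 1)))" by simp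
qed auto

end

section \<open>The uncertainty principle\<close>

text \<open>Applied at x = M^(j+1) for every \<open>j\<close>: the first bound pays for the union
  bounds, and the second at x = M provides \<open>4 \<le> y\<close> in
  \<open>Ex_good_set\<close>.\<close>

lemma eventually_exp_dominates:
  fixes \<epsilon> :: real
  assumes "0 < \<epsilon>"
  shows "\<exists>x0. \<forall>x\<ge>x0. 32 * x\<^sup>2 \<le> exp (x powr (2 * \<epsilon>) / 4) \<and> 4 \<le> x powr (2 * \<epsilon>)"
proof -
  have "eventually (\<lambda>x. 32 * x\<^sup>2 \<le> exp (x powr (2 * \<epsilon>) / 4)) at_top" using assms by real_asymp
  moreover have "eventually (\<lambda>x. 4 \<le> x powr (2 * \<epsilon>)) at_top" using assms by real_asymp
  ultimately show ?thesis unfolding eventually_at_top_linorder[symmetric] by eventually_elim auto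
qed

lemma (in real_distribution) L2_nrm_nonneg: "0 \<le> L2_nrm M u"
  by (simp add: L2_nrm_def)

context cantor_choice
begin

text \<open>Decay and the trivial bound combine to |char((x-y)/h)| \<le> 34 h^\<alpha> max(h,
  |x-y|)^(-\<alpha>). The energy bound makes the row integrals at most 34 * 40 h^\<alpha> = 1360
  h^\<alpha>, and 1360 \<le> 40^2 allows a clean square root.\<close>

lemma fourier_op_le:
  assumes step: "\<And>j t. cmod (step_sum M A w j t) \<le> 4 * (real M powr (-\<alpha>)) ^ Suc j"
    and first: "\<And>b. b \<le> M \<Longrightarrow>
      (\<Sum>a\<in>w 1 0. (real M / max 1 \<bar>real a - real b\<bar>) powr \<alpha>) \<le> 18 * real A"
    and a: "0 < \<alpha>" "\<alpha> \<le> 1/2" "2 \<le> real M powr \<alpha>"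
      "real M powr (2 * \<alpha>) \<le> real A" "4 * real M powr \<alpha> \<le> real A"
    and h: "0 < h" and u: "u \<in> L2_fun (cantor_measure M A w)"
  shows "L2_nrm (cantor_measure M A w) (fourier_op (cantor_measure M A w) h u)
    \<le> 40 * h powr (\<alpha> / 2) * L2_nrm (cantor_measure M A w) u"
proof -
  let ?\<nu> = "cantor_measure M A w"
  interpret \<nu>: real_distribution ?\<nu> by (rule real_distribution_cantor)
  have "(LINT y|?\<nu>. cmod (char ?\<nu> ((x - y) / h))) \<le> 1360 * h powr \<alpha>" for x
  proof -
    have "(LINT y|?\<nu>. cmod (char ?\<nu> ((x - y) / h))) \<le> (LINT y|?\<nu>. 34 * h powr \<alpha> * max h \<bar>x - y\<bar> powr (-\<alpha>))"
    proof (rule integral_mono')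
      show "integrable ?\<nu> (\<lambda>y. 34 * h powr \<alpha> * max h \<bar>x - y\<bar> powr (-\<alpha>))"
      proof (rule \<nu>.integrable_const_bound[where B = "34 * h powr \<alpha> * h powr (-\<alpha>)"])
        show "AE y in ?\<nu>. norm (34 * h powr \<alpha> * max h \<bar>x - y\<bar> powr (-\<alpha>)) \<le> 34 * h powr \<alpha> * h powr (-\<alpha>)"
          using h a by (intro AE_I2) (auto simp: abs_mult intro!: mult_left_mono powr_mono2')
      qed measurable
      fix y
      show "cmod (char ?\<nu> ((x - y) / h)) \<le> 34 * h powr \<alpha> * max h \<bar>x - y\<bar> powr (-\<alpha>)"
      proof (cases "\<bar>x - y\<bar> \<le> h")
        case True
        then have "34 * h powr \<alpha> * max h \<bar>x - y\<bar> powr (-\<alpha>) = 34"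
          using h by (simp add: max_absorb1 powr_minus)
        then show ?thesis using \<nu>.cmod_char_le_1[of "(x - y) / h"] by linarith
      next
        case False
        then have "(x - y) / h \<noteq> 0" using h by auto
        from char_cantor_le[OF step a(1-3) this]
        have "cmod (char ?\<nu> ((x - y) / h)) \<le> 34 * (\<bar>x - y\<bar> / h) powr (-\<alpha>)"
          using h by (simp add: abs_divide)
        also have "\<dots> = 34 * h powr \<alpha> * max h \<bar>x - y\<bar> powr (-\<alpha>)"
          using False h by (simp add: max_absorb2 powr_minus powr_divide inverse_eq_divide)
        finally show ?thesis .
      qed
    qed auto
    also have "\<dots> = 34 * h powr \<alpha> * (LINT y|?\<nu>. max h \<bar>x - y\<bar> powr (-\<alpha>))" by simp
    also have "\<dots> \<le> 34 * h powr \<alpha> * 40"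
      using energy_le[OF first a(1) _ a(4,5) h] a(2) by (intro mult_left_mono) auto
    finally show ?thesis by simp
  qed
  then have "(L2_nrm ?\<nu> (fourier_op ?\<nu> h u))\<^sup>2 \<le> 1360 * h powr \<alpha> * (L2_nrm ?\<nu> u)\<^sup>2"
    by (rule \<nu>.L2_nrm_fourier_op_le[OF u])
  also have "\<dots> \<le> 1600 * h powr \<alpha> * (L2_nrm ?\<nu> u)\<^sup>2"
    by (intro mult_right_mono) auto
  also have "h powr \<alpha> = (h powr (\<alpha> / 2))\<^sup>2" using h by (simp add: power2_eq_square powr_add[symmetric])
  also have "1600 * \<dots> * (L2_nrm ?\<nu> u)\<^sup>2 = (40 * h powr (\<alpha> / 2) * L2_nrm ?\<nu> u)\<^sup>2"
    by (simp add: power_mult_distrib)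
  finally show ?thesis
    by (rule power2_le_imp_le) (simp add: \<nu>.L2_nrm_nonneg)
qed

text \<open>Schur's test with the trivial bound 1 on the characteristic function.\<close>

lemma fourier_op_le_L2_nrm:
  assumes u: "u \<in> L2_fun (cantor_measure M A w)"
  shows "L2_nrm (cantor_measure M A w) (fourier_op (cantor_measure M A w) h u) \<le> L2_nrm (cantor_measure M A w) u"
proof -
  let ?\<nu> = "cantor_measure M A w"
  interpret \<nu>: real_distribution ?\<nu> by (rule real_distribution_cantor)
  have "(LINT y|?\<nu>. cmod (char ?\<nu> ((x - y) / h))) \<le> 1" for x
  proof -
    have "(LINT y|?\<nu>. cmod (char ?\<nu> ((x - y) / h))) \<le> (LINT y|?\<nu>. 1)"
      by (rule integral_mono') (auto simp: \<nu>.cmod_char_le_1)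
    then show ?thesis using \<nu>.prob_space by simp
  qed
  then have "(L2_nrm ?\<nu> (fourier_op ?\<nu> h u))\<^sup>2 \<le> 1 * (L2_nrm ?\<nu> u)\<^sup>2"
    by (rule \<nu>.L2_nrm_fourier_op_le[OF u])
  then show ?thesis
    unfolding mult_1 by (rule power2_le_imp_le) (rule \<nu>.L2_nrm_nonneg)
qed

end

context cantor_parameters
begin

text \<open>The exponent for step j + 1 is y^(j+1) / 2; half of it pays for the grid and the rest
  leaves at most r^(j+1) with r = exp(-y/4) \<le> 1/2. The steps sum to at most 2 r, and the
  first-alphabet events add at most r.\<close>

lemma Ex_good_set:
  fixes \<alpha> y :: real
  assumes \<alpha>: "0 < \<alpha>" "\<alpha> \<le> 1/2" and y: "4 \<le> y" "real A * (real M powr (-\<alpha>))\<^sup>2 = y" "y \<le> real A / real M powr \<alpha>"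
    and large: "\<And>j. 32 * real M ^ (2 * Suc j) \<le> exp (y ^ Suc j / 4)"
  shows "\<exists>G\<in>sets (mu_inf M A). measure (mu_inf M A) (space (mu_inf M A) - G) \<le> 3 * exp (- (y / 4)) \<and>
    (\<forall>w\<in>G. w \<in> space (mu_inf M A) \<and> (\<forall>j t. cmod (step_sum M A w j t) \<le> 4 * (real M powr (-\<alpha>)) ^ Suc j) \<and>
      (\<forall>b\<le>M. (\<Sum>a\<in>w 1 0. (real M / max 1 \<bar>real a - real b\<bar>) powr \<alpha>) \<le> 18 * real A))"
proof -
  interpret prob_space "mu_inf M A" by (rule prob_space_mu_inf)
  let ?\<Omega> = "space (mu_inf M A)"
  define X where "X j = {w \<in> ?\<Omega>. \<exists>t. 4 * (real M powr (-\<alpha>)) ^ Suc j < cmod (step_sum M A w j t)}" for j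
  define Y where "Y b = {w \<in> ?\<Omega>. 18 * real A < (\<Sum>a\<in>w 1 0. (real M / max 1 \<bar>real a - real b\<bar>) powr \<alpha>)}" for b
  have X_sets: "X j \<in> sets (mu_inf M A)" for j unfolding X_def by (rule sets_step_sum_bounded)
  have Y_sets: "Y b \<in> sets (mu_inf M A)" for b unfolding Y_def by (rule sets_first_alphabet)
  define r where "r = exp (- (y / 4))"
  have r: "0 < r" "r \<le> 1/2"
  proof -
    have "r \<le> exp (-1)" unfolding r_def using y by simp
    also have "\<dots> \<le> 1/2" using exp_ge_add_one_self[of 1] by (simp add: exp_minus field_simps)
    finally show "r \<le> 1/2" .
  qed (simp add: r_def)
  have pX: "prob (X j) \<le> r ^ Suc j" for j
  proof -
    have "1 / real M ^ Suc j \<le> (real M powr (-\<alpha>)) ^ Suc j"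
    proof -
      have "real M powr \<alpha> \<le> real M powr 1" using M2 \<alpha> by (intro powr_mono) auto
      then have "1 / real M \<le> real M powr (-\<alpha>)" using M2 by (simp add: powr_minus divide_inverse)
      then have "(1 / real M) ^ Suc j \<le> (real M powr (-\<alpha>)) ^ Suc j" by (intro power_mono) auto
      then show ?thesis by (simp add: power_one_over divide_inverse power_inverse)
    qed
    from measure_step_sum_bounded[OF this]
    have "prob (X j) \<le> 32 * real M ^ (2 * Suc j) * exp (- (real A ^ Suc j * ((real M powr (-\<alpha>)) ^ Suc j)\<^sup>2 / 2))"
      unfolding X_def .
    also have "real A ^ Suc j * ((real M powr (-\<alpha>)) ^ Suc j)\<^sup>2 = y ^ Suc j"
      unfolding y(2)[symmetric] by (simp only: power_mult_distrib power_mult[symmetric] mult.commute)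
    also have "32 * real M ^ (2 * Suc j) * exp (- (y ^ Suc j / 2)) \<le> exp (y ^ Suc j / 4) * exp (- (y ^ Suc j / 2))"
      by (intro mult_right_mono large) auto
    also have "\<dots> = exp (- (y ^ Suc j / 4))" by (simp add: exp_add[symmetric])
    \<comment> \<open>Since y \<ge> 4, the super-exponential y^(j+1) is at least (j+1) y, which
      makes the tail geometric in \<open>j\<close>.\<close>
    also have "\<dots> \<le> exp (real (Suc j) * (- (y / 4)))"
    proof -
      have "real (Suc j) * y \<le> y ^ Suc j"
      proof -
        have "real (Suc j) \<le> 2 ^ j" by (induction j) auto
        also have "\<dots> \<le> y ^ j" using y(1) by (intro power_mono) auto
        finally show ?thesis using y(1) by (simp add: mult_right_mono)
      qed
      then show ?thesis by simp
    qed
    also have "\<dots> = r ^ Suc j" unfolding r_def by (rule exp_of_nat_mult)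
    finally show ?thesis .
  qed
  have "prob (\<Union>j. X j) \<le> (\<Sum>j. prob (X j))"
  proof (rule finite_measure_subadditive_countably)
    show "summable (\<lambda>j. prob (X j))"
      by (rule summable_comparison_test'[of "\<lambda>j. r ^ Suc j"])
        (use pX r in \<open>auto simp del: power_Suc simp: summable_Suc_iff intro!: summable_geometric\<close>)
  qed (use X_sets in auto)
  also have "\<dots> \<le> (\<Sum>j. r ^ Suc j)"
    using pX r by (intro suminf_le summable_comparison_test'[of "\<lambda>j. r ^ Suc j" 0 "\<lambda>j. prob (X j)"])
        (auto simp del: power_Suc simp: summable_Suc_iff intro!: summable_geometric)
  also have "\<dots> = r * (1 / (1 - r))" using r by (simp add: suminf_mult suminf_geometric)
  also have "\<dots> \<le> r * 2" using r by (intro mult_left_mono) (auto simp: field_simps)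
  finally have X: "prob (\<Union>j. X j) \<le> 2 * r" by simp
  have Y: "prob (\<Union>b\<le>M. Y b) \<le> r"
  proof -
    have "prob (\<Union>b\<le>M. Y b) \<le> (\<Sum>b\<le>M. prob (Y b))"
      using Y_sets by (intro finite_measure_subadditive_finite) auto
    also have "\<dots> \<le> (\<Sum>b\<le>M. exp (- (y / 2)))"
    proof (rule sum_mono)
      fix b assume "b \<in> {..M}"
      then have "prob (Y b) \<le> exp (- (6 * real A / real M powr \<alpha>))"
        unfolding Y_def by (intro measure_first_alphabet \<alpha>) auto
      also have "\<dots> \<le> exp (- (y / 2))" using y by simp
      finally show "prob (Y b) \<le> exp (- (y / 2))" .
    qed
    also have "\<dots> = (real M + 1) * exp (- (y / 2))" by simp
    \<comment> \<open>The bound \<open>large\<close> at j = 0 also dominates the M + 1 events of the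
      first alphabet.\<close>
    also have "\<dots> \<le> exp (y / 4) * exp (- (y / 2))"
    proof (intro mult_right_mono)
      have "real M + 1 \<le> 32 * (real M * real M)"
        using M2 mult_mono[of 1 "real M" 1 "real M"] mult_left_mono[of 1 "real M" "real M"] by linarith
      then show "real M + 1 \<le> exp (y / 4)" using large[of 0] by (simp add: power2_eq_square)
    qed auto
    also have "\<dots> = r" by (simp add: r_def exp_add[symmetric])
    finally show ?thesis .
  qed
  define G where "G = ?\<Omega> - ((\<Union>j. X j) \<union> (\<Union>b\<le>M. Y b))"
  have "?\<Omega> - G = (\<Union>j. X j) \<union> (\<Union>b\<le>M. Y b)" by (auto simp: G_def X_def Y_def)
  then have "prob (?\<Omega> - G) \<le> prob (\<Union>j. X j) + prob (\<Union>b\<le>M. Y b)"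
    using X_sets Y_sets by (auto intro!: measure_Un_le)
  with X Y have "prob (?\<Omega> - G) \<le> 3 * exp (- (y / 4))" by (simp add: r_def)
  moreover have "G \<in> sets (mu_inf M A)" unfolding G_def using X_sets Y_sets by auto
  moreover have "\<forall>w\<in>G. w \<in> ?\<Omega> \<and> (\<forall>j t. cmod (step_sum M A w j t) \<le> 4 * (real M powr (-\<alpha>)) ^ Suc j) \<and>
      (\<forall>b\<le>M. (\<Sum>a\<in>w 1 0. (real M / max 1 \<bar>real a - real b\<bar>) powr \<alpha>) \<le> 18 * real A)"
    unfolding G_def X_def Y_def by (auto simp: not_less simp del: power_Suc)
  ultimately show ?thesis by blast
qed

end

theorem theorem1p4:
  "\<exists>C::real. C > 0 \<and> (\<exists>C1::real \<Rightarrow> real. (\<forall>\<epsilon>. C1 \<epsilon> > 0) \<and>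
    (\<forall>(\<delta>::real) (M::nat) (A::nat).
      0 < \<delta> \<longrightarrow> \<delta> < 2 / 3 \<longrightarrow> real M \<ge> 2 powr (4 / \<delta>) \<longrightarrow> real A = real M powr \<delta> \<longrightarrow>
      (\<forall>\<epsilon>::real. 0 < \<epsilon> \<longrightarrow> \<epsilon> < \<delta> / 2 \<longrightarrow>
        (\<exists>G \<in> sets (mu_inf M A).
          measure (mu_inf M A) (space (mu_inf M A) - G) \<le> C1 \<epsilon> * exp (- (real M powr \<epsilon> / C)) \<and>
          (\<forall>w\<in>G. \<forall>u \<in> L2_fun (cantor_measure M A w). \<forall>h::real.
            0 < h \<longrightarrow> h < real M powr (- 8) \<longrightarrow>
              fourier_op (cantor_measure M A w) h u \<in> L2_fun (cantor_measure M A w) \<and>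
              L2_nrm (cantor_measure M A w) (fourier_op (cantor_measure M A w) h u)
                \<le> C * h powr (\<delta> / 4 - \<epsilon>) * L2_nrm (cantor_measure M A w) u)))))"
proof -
  obtain x0 :: "real \<Rightarrow> real" where x0: "\<And>\<epsilon> x. 0 < \<epsilon> \<Longrightarrow> x0 \<epsilon> \<le> x \<Longrightarrow>
      32 * x\<^sup>2 \<le> exp (x powr (2 * \<epsilon>) / 4) \<and> 4 \<le> x powr (2 * \<epsilon>)"
    using eventually_exp_dominates by metis
  \<comment> \<open>The summand 3 is the constant of \<open>Ex_good_set\<close>; the exponential
    makes the probability bound at least 1 when \<open>M\<close> is below the threshold
    \<open>x0 \<epsilon>\<close>.\<close>
  define C1 where "C1 \<epsilon> = 3 + exp (x0 \<epsilon> powr \<epsilon>)" for \<epsilon>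
  show ?thesis
  proof (intro exI[of _ 40] conjI exI[of _ C1] allI impI)
    show "0 < C1 \<epsilon>" for \<epsilon> by (simp add: C1_def add_pos_pos)
    fix \<delta> \<epsilon> :: real and M A :: nat
    assume \<delta>: "0 < \<delta>" "\<delta> < 2 / 3" and M: "2 powr (4 / \<delta>) \<le> real M" and A: "real A = real M powr \<delta>"
      and \<epsilon>: "0 < \<epsilon>" "\<epsilon> < \<delta> / 2"
    have "2 powr 1 \<le> 2 powr (4 / \<delta>)" using \<delta> by (intro powr_mono) (auto simp: field_simps)
    with M have M2: "2 \<le> real M" by simp
    have "(2 powr (4 / \<delta>)) powr \<delta> \<le> real M powr \<delta>" using M \<delta> by (intro powr_mono2) auto
    then have A16: "16 \<le> real M powr \<delta>" using \<delta> by (simp add: powr_powr)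
    have "real M powr \<delta> \<le> real M powr 1" using M2 \<delta> by (intro powr_mono) auto
    then have "A \<le> M" using A M2 by simp
    interpret cantor_parameters M A
      by unfold_locales (use M2 A16 A \<open>A \<le> M\<close> in auto)
    interpret prob_space "mu_inf M A" by (rule prob_space_mu_inf)
    let ?good = "\<lambda>w. \<forall>u \<in> L2_fun (cantor_measure M A w). \<forall>h::real.
            0 < h \<longrightarrow> h < real M powr (- 8) \<longrightarrow>
              fourier_op (cantor_measure M A w) h u \<in> L2_fun (cantor_measure M A w) \<and>
              L2_nrm (cantor_measure M A w) (fourier_op (cantor_measure M A w) h u)
                \<le> 40 * h powr (\<delta> / 4 - \<epsilon>) * L2_nrm (cantor_measure M A w) u"
    have h1: "h < 1" if "h < real M powr (-8)" for h
    proof -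
      have "real M powr (-8) \<le> real M powr 0" using M2 by (intro powr_mono) auto
      then show ?thesis using that M2 by simp
    qed
    show "\<exists>G \<in> sets (mu_inf M A).
        measure (mu_inf M A) (space (mu_inf M A) - G) \<le> C1 \<epsilon> * exp (- (real M powr \<epsilon> / 40)) \<and> (\<forall>w\<in>G. ?good w)"
    proof (cases "real M < x0 \<epsilon>")
      case True
      have "real M powr \<epsilon> / 40 \<le> x0 \<epsilon> powr \<epsilon>"
      proof -
        have "real M powr \<epsilon> \<le> x0 \<epsilon> powr \<epsilon>" using True \<epsilon> by (intro powr_mono2) auto
        moreover have "0 \<le> real M powr \<epsilon>" by simp
        ultimately show ?thesis by linarith
      qed
      \<comment> \<open>The required bound exceeds 1, so the empty set is admissible as
        \<open>G\<close>.\<close>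
      then have "1 \<le> exp (x0 \<epsilon> powr \<epsilon>) * exp (- (real M powr \<epsilon> / 40))"
        by (simp add: exp_add[symmetric])
      also have "\<dots> \<le> C1 \<epsilon> * exp (- (real M powr \<epsilon> / 40))"
        by (intro mult_right_mono) (auto simp: C1_def)
      finally show ?thesis
        by (intro bexI[of _ "{}"]) (auto intro: order_trans[OF prob_le_1])
    next
      case large: False
      show ?thesis
      proof (cases "\<delta> / 4 \<le> \<epsilon>")
        case True
        have "?good w" if w: "w \<in> space (mu_inf M A)" for w
        proof (intro ballI allI impI conjI)
          interpret cantor_choice M A w by (rule cantor_choice_mu_inf[OF w])
          interpret \<nu>: real_distribution "cantor_measure M A w" by (rule real_distribution_cantor)
          fix u h assume u: "u \<in> L2_fun (cantor_measure M A w)" and h: "0 < h" "h < real M powr (-8)"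
          show "fourier_op (cantor_measure M A w) h u \<in> L2_fun (cantor_measure M A w)"
            by (rule \<nu>.fourier_op_in_L2[OF u])
          \<comment> \<open>The exponent is nonpositive and h < 1, so the power is at least 1 and
            every outcome is good.\<close>
          have "h powr 0 \<le> h powr (\<delta> / 4 - \<epsilon>)" using True h h1[OF h(2)] by (intro powr_mono') auto
          then have "1 \<le> 40 * h powr (\<delta> / 4 - \<epsilon>)" using h by simp
          from mult_right_mono[OF this \<nu>.L2_nrm_nonneg[of u]]
          show "L2_nrm (cantor_measure M A w) (fourier_op (cantor_measure M A w) h u)
                \<le> 40 * h powr (\<delta> / 4 - \<epsilon>) * L2_nrm (cantor_measure M A w) u"
            using fourier_op_le_L2_nrm[OF u, of h] by simp
        qed
        moreover have "0 < C1 \<epsilon>" by (simp add: C1_def add_pos_pos)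
        ultimately show ?thesis by (intro bexI[of _ "space (mu_inf M A)"]) auto
      next
        case False
        define \<alpha> where "\<alpha> = \<delta> / 2 - \<epsilon>"
        define y where "y = real M powr (2 * \<epsilon>)"
        have \<alpha>: "0 < \<alpha>" "\<alpha> \<le> 1/2" using \<epsilon> \<delta> by (auto simp: \<alpha>_def)
        have M\<alpha>: "2 \<le> real M powr \<alpha>"
        \<comment> \<open>In this case \<alpha> > \<delta>/4, and M^\<delta> \<ge> 16 gives
          M^(\<delta>/4) \<ge> 2.\<close>
        proof -
          have "(2::real) = (2 powr 4) powr (1/4)" by (simp only: powr_powr) simp
          also have "\<dots> \<le> (real M powr \<delta>) powr (1/4)" using A16 by (intro powr_mono2) auto
          also have "\<dots> \<le> real M powr \<alpha>"
            unfolding powr_powr using False M2 by (intro powr_mono) (auto simp: \<alpha>_def)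
          finally show ?thesis .
        qed
        have M2\<alpha>: "real M powr (2 * \<alpha>) \<le> real A"
          unfolding A using M2 \<epsilon> by (intro powr_mono) (auto simp: \<alpha>_def)
        have M4\<alpha>: "4 * real M powr \<alpha> \<le> real A"
        \<comment> \<open>M^(\<delta>/2) \<ge> 4, and \<delta>/2 + \<alpha> = \<delta> - \<epsilon>
          is below \<delta>.\<close>
        proof -
          have "(4::real) = (2 powr 4) powr (1/2)" by (simp only: powr_powr) simp
          also have "\<dots> \<le> (real M powr \<delta>) powr (1/2)" using A16 by (intro powr_mono2) auto
          finally have "4 * real M powr \<alpha> \<le> (real M powr \<delta>) powr (1/2) * real M powr \<alpha>"
            by (intro mult_right_mono) auto
          also have "\<dots> \<le> real A"
            unfolding A powr_powr powr_add[symmetric] using M2 \<epsilon> by (intro powr_mono) (auto simp: \<alpha>_def)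
          finally show ?thesis .
        qed
        have "\<exists>G\<in>sets (mu_inf M A). measure (mu_inf M A) (space (mu_inf M A) - G) \<le> 3 * exp (- (y / 4)) \<and>
          (\<forall>w\<in>G. w \<in> space (mu_inf M A) \<and> (\<forall>j t. cmod (step_sum M A w j t) \<le> 4 * (real M powr (-\<alpha>)) ^ Suc j) \<and>
          (\<forall>b\<le>M. (\<Sum>a\<in>w 1 0. (real M / max 1 \<bar>real a - real b\<bar>) powr \<alpha>) \<le> 18 * real A))"
        proof (rule Ex_good_set[OF \<alpha>])
          show "4 \<le> y" using x0[OF \<epsilon>(1), of "real M"] large by (simp add: y_def)
          show "real A * (real M powr (-\<alpha>))\<^sup>2 = y"
            unfolding A y_def power2_eq_square powr_add[symmetric] by (simp add: \<alpha>_def)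
          show "y \<le> real A / real M powr \<alpha>"
            unfolding A y_def powr_diff[symmetric] using M2 False \<epsilon> by (intro powr_mono) (auto simp: \<alpha>_def)
          fix j
          have "real M ^ 1 \<le> real M ^ Suc j" using M2 by (intro power_increasing) auto
          then have "x0 \<epsilon> \<le> real M ^ Suc j" using large by simp
          then have "32 * (real M ^ Suc j)\<^sup>2 \<le> exp ((real M ^ Suc j) powr (2 * \<epsilon>) / 4)"
            using x0[OF \<epsilon>(1)] by blast
          moreover have "(real M ^ Suc j) powr (2 * \<epsilon>) = y ^ Suc j"
            unfolding y_def using M2 by (simp add: powr_realpow[symmetric] powr_powr mult.commute del: power_Suc of_nat_Suc)
          ultimately show "32 * real M ^ (2 * Suc j) \<le> exp (y ^ Suc j / 4)"
            by (simp only: power_mult[symmetric] mult.commute)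
        qed
        then obtain G where G: "G \<in> sets (mu_inf M A)" "measure (mu_inf M A) (space (mu_inf M A) - G) \<le> 3 * exp (- (y / 4))"
          and Gw: "\<And>w. w \<in> G \<Longrightarrow> w \<in> space (mu_inf M A)"
            "\<And>w j t. w \<in> G \<Longrightarrow> cmod (step_sum M A w j t) \<le> 4 * (real M powr (-\<alpha>)) ^ Suc j"
            "\<And>w b. w \<in> G \<Longrightarrow> b \<le> M \<Longrightarrow> (\<Sum>a\<in>w 1 0. (real M / max 1 \<bar>real a - real b\<bar>) powr \<alpha>) \<le> 18 * real A"
          by blast
        have "3 * exp (- (y / 4)) \<le> C1 \<epsilon> * exp (- (real M powr \<epsilon> / 40))"
        proof (rule mult_mono)
          have "real M powr \<epsilon> \<le> y" unfolding y_def using M2 \<epsilon> by (intro powr_mono) auto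
          moreover have "0 \<le> real M powr \<epsilon>" by simp
          ultimately have "real M powr \<epsilon> / 40 \<le> y / 4" by linarith
          then show "exp (- (y / 4)) \<le> exp (- (real M powr \<epsilon> / 40))" by simp
        qed (auto simp: C1_def add_nonneg_nonneg)
        moreover have "?good w" if w: "w \<in> G" for w
        proof (intro ballI allI impI conjI)
          interpret cantor_choice M A w by (rule cantor_choice_mu_inf[OF Gw(1)[OF w]])
          interpret \<nu>: real_distribution "cantor_measure M A w" by (rule real_distribution_cantor)
          fix u h assume u: "u \<in> L2_fun (cantor_measure M A w)" and h: "0 < h" "h < real M powr (-8)"
          show "fourier_op (cantor_measure M A w) h u \<in> L2_fun (cantor_measure M A w)"
            by (rule \<nu>.fourier_op_in_L2[OF u])
          have "L2_nrm (cantor_measure M A w) (fourier_op (cantor_measure M A w) h u)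
                \<le> 40 * h powr (\<alpha> / 2) * L2_nrm (cantor_measure M A w) u"
            by (rule fourier_op_le[OF Gw(2,3)[OF w] \<alpha> M\<alpha> M2\<alpha> M4\<alpha> h(1) u])
          \<comment> \<open>\<alpha>/2 = \<delta>/4 - \<epsilon>/2 exceeds the required exponent,
            and h < 1.\<close>
          also have "\<dots> \<le> 40 * h powr (\<delta> / 4 - \<epsilon>) * L2_nrm (cantor_measure M A w) u"
            using h h1[OF h(2)] \<epsilon>
            by (intro mult_right_mono mult_left_mono powr_mono' \<nu>.L2_nrm_nonneg) (auto simp: \<alpha>_def)
          finally show "L2_nrm (cantor_measure M A w) (fourier_op (cantor_measure M A w) h u)
                \<le> 40 * h powr (\<delta> / 4 - \<epsilon>) * L2_nrm (cantor_measure M A w) u" .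
        qed
        ultimately show ?thesis using G by (intro bexI[of _ G]) auto
      qed
    qed
  qed auto
qed

end
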